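(* For every infinite cardinal $\tau$ there exist a compact Hausdorff space $K$ and a real Banach space $X$ such that $\mathrm{cf}(\tau) = \mathrm{w}(K)$, the space $C(K,X)$ contains a complemented copy of $c_0(\tau)$, and $X$ does not contain a complemented copy of $c_0(\tau)$.
   Context: All Banach spaces are real. $C(K,X)$ is the Banach space of all continuous $X$-valued functions on $K$ with the supremum norm. For a non-empty set $\Gamma$, $c_0(\Gamma)$ is the Banach space of all real-valued maps $f$ on $\Gamma$ such that for each $\varepsilon>0$ the set $\{\gamma\in\Gamma : |f(\gamma)|\ge\varepsilon\}$ is finite, with the supremum norm; $c_0(\tau)$ denotes $c_0(\Gamma)$ for $\Gamma$ of cardinality $\tau$ (one may take $\Gamma=\tau$). A Banach space $Y$ contains a complemented copy of a Banach space $Z$ if $Z$ is isomorphic (linearly homeomorphic) to a complemented subspace of $Y$, that is, to a closed subspace of $Y$ which is the range of a bounded linear projection on $Y$. The cofinality $\mathrm{cf}(\tau)$ is the least cardinal $\alpha$ such that there is a family of ordinals $\{\beta_i : i\in\alpha\}$ with $\beta_i<\tau$ for all $i\in\alpha$ and $\sup\{\beta_i : i\in\alpha\}=\tau$. The weight $\mathrm{w}(K)$ is the least cardinality of an open topological basis of $K$. *)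

theory Defs
  imports "HOL-Analysis.Analysis" "HOL-Library.Function_Algebras"
begin

unbundle cardinal_syntax

text \<open>A cardinal is a relation satisfying \<^const>\<open>Card_order\<close>; the ordinals below it are the
  elements of its field. For an infinite cardinal \<open>r\<close>, the supremum of a set of ordinals below
  \<open>r\<close> is \<open>r\<close> iff the set is \<^const>\<open>cofinal\<close> in \<open>r\<close>. Only index cardinals over the type of \<open>r\<close> are
  considered: the identity family is indexed by \<open>r\<close>, so the least index cardinal is at most \<open>r\<close>.\<close>

definition has_cofinal_family :: "'a rel \<Rightarrow> 'a rel \<Rightarrow> bool" where
  "has_cofinal_family r \<alpha> \<longleftrightarrow> Card_order \<alpha> \<and>
     (\<exists>\<beta>. \<beta> ` Field \<alpha> \<subseteq> Field r \<and> cofinal (\<beta> ` Field \<alpha>) r)"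

definition is_cofinality :: "'a rel \<Rightarrow> 'a rel \<Rightarrow> bool" where
  "is_cofinality r \<alpha> \<longleftrightarrow> has_cofinal_family r \<alpha> \<and> (\<forall>\<alpha>'. has_cofinal_family r \<alpha>' \<longrightarrow> \<alpha> \<le>o \<alpha>')"

definition cofinality :: "'a rel \<Rightarrow> 'a rel" where
  "cofinality r = (SOME \<alpha>. is_cofinality r \<alpha>)"

lemma is_cofinality_cofinality:
  assumes "Cinfinite r"
  shows "is_cofinality r (cofinality r)"
proof -
  have "\<exists>b\<in>Field r. a \<noteq> b \<and> (a, b) \<in> r" if "a \<in> Field r" for a
    using infinite_Card_order_limit[of r a] assms that by (simp add: cinfinite_def)
  hence "cofinal (id ` Field r) r"
    unfolding cofinal_def by simp
  hence "has_cofinal_family r r"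
    using assms unfolding has_cofinal_family_def by (metis id_apply image_id order_refl)
  hence "\<exists>\<alpha>\<in>Collect (has_cofinal_family r). \<forall>\<alpha>'\<in>Collect (has_cofinal_family r). \<alpha> \<le>o \<alpha>'"
    by (intro exists_minim_Card_order) (auto simp: has_cofinal_family_def)
  hence "\<exists>\<alpha>. is_cofinality r \<alpha>"
    by (simp add: is_cofinality_def)
  thus ?thesis
    unfolding cofinality_def by (rule someI_ex)
qed

definition topology_base :: "'k topology \<Rightarrow> 'k set set \<Rightarrow> bool" where
  "topology_base K \<B> \<longleftrightarrow> (\<forall>B\<in>\<B>. openin K B) \<and>
     (\<forall>U x. openin K U \<longrightarrow> x \<in> U \<longrightarrow> (\<exists>B\<in>\<B>. x \<in> B \<and> B \<subseteq> U))"

definition is_weight :: "'k topology \<Rightarrow> 'k set rel \<Rightarrow> bool" where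
  "is_weight K \<kappa> \<longleftrightarrow> (\<exists>\<B>. topology_base K \<B> \<and> \<kappa> = |\<B>| ) \<and>
     (\<forall>\<B>. topology_base K \<B> \<longrightarrow> \<kappa> \<le>o |\<B>| )"

definition weight :: "'k topology \<Rightarrow> 'k set rel" where
  "weight K = (SOME \<kappa>. is_weight K \<kappa>)"

lemma is_weight_weight: "is_weight K (weight K)"
proof -
  have "topology_base K (Collect (openin K))"
    by (auto simp: topology_base_def)
  hence "\<exists>\<kappa>. is_weight K \<kappa>"
    using exists_minim_Card_order[of "card_of ` Collect (topology_base K)"]
    unfolding is_weight_def using card_of_Card_order by blast
  thus ?thesis
    unfolding weight_def by (rule someI_ex)
qed

instantiation "fun" :: (type, real_vector) real_vector
begin

definition "c *\<^sub>R f = (\<lambda>x. c *\<^sub>R f x)"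

instance
  by standard (simp_all only: fun_eq_iff scaleR_fun_def plus_fun_def scaleR_add_right scaleR_add_left scaleR_scaleR scaleR_one simp_thms)

end

text \<open>A normed space is a linear subspace of some real vector space together with a norm that is
  only meaningful on that subspace.\<close>

record 'v nspace =
  vecs :: "'v set"
  nrm :: "'v \<Rightarrow> real"

definition normed_space :: "'v::real_vector nspace \<Rightarrow> bool" where
  "normed_space X \<longleftrightarrow> subspace (vecs X) \<and>
     (\<forall>x\<in>vecs X. 0 \<le> nrm X x \<and> (nrm X x = 0 \<longleftrightarrow> x = 0)) \<and>
     (\<forall>c. \<forall>x\<in>vecs X. nrm X (c *\<^sub>R x) = \<bar>c\<bar> * nrm X x) \<and>
     (\<forall>x\<in>vecs X. \<forall>y\<in>vecs X. nrm X (x + y) \<le> nrm X x + nrm X y)"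

text \<open>The locale \<^locale>\<open>Metric_space\<close> requires nonnegativity and symmetry also off the carrier, hence
  the value 0 there.\<close>

definition ndist :: "'v::real_vector nspace \<Rightarrow> 'v \<Rightarrow> 'v \<Rightarrow> real" where
  "ndist X x y = (if x \<in> vecs X \<and> y \<in> vecs X then nrm X (x - y) else 0)"

lemma Metric_space_ndist:
  assumes "normed_space X"
  shows "Metric_space (vecs X) (ndist X)"
proof -
  have sub: "x - y \<in> vecs X" if "x \<in> vecs X" "y \<in> vecs X" for x y
    using assms that subspace_diff unfolding normed_space_def by blast
  have pos: "0 \<le> nrm X x" "nrm X x = 0 \<longleftrightarrow> x = 0" if "x \<in> vecs X" for x
    using assms that unfolding normed_space_def by blast+
  have hom: "nrm X (c *\<^sub>R x) = \<bar>c\<bar> * nrm X x" if "x \<in> vecs X" for c x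
    using assms that unfolding normed_space_def by blast
  have tri: "nrm X (x + y) \<le> nrm X x + nrm X y" if "x \<in> vecs X" "y \<in> vecs X" for x y
    using assms that unfolding normed_space_def by blast
  show ?thesis
  proof
    fix x y
    show "0 \<le> ndist X x y"
      using pos sub by (simp add: ndist_def)
    show "ndist X x y = ndist X y x"
    proof (cases "x \<in> vecs X \<and> y \<in> vecs X")
      case True
      thus ?thesis
        using hom[OF sub[of y x], of "-1"] by (simp add: ndist_def)
    qed (auto simp: ndist_def)
  next
    fix x y
    assume "x \<in> vecs X" "y \<in> vecs X"
    thus "ndist X x y = 0 \<longleftrightarrow> x = y"
      using pos sub[of x y] by (simp add: ndist_def)
  next
    fix x y z
    assume xyz: "x \<in> vecs X" "y \<in> vecs X" "z \<in> vecs X"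
    thus "ndist X x z \<le> ndist X x y + ndist X y z"
      using tri[OF sub sub, of x y y z] by (simp add: ndist_def)
  qed
qed

definition ntopology :: "'v::real_vector nspace \<Rightarrow> 'v topology" where
  "ntopology X = Metric_space.mtopology (vecs X) (ndist X)"

definition banach_space :: "'v::real_vector nspace \<Rightarrow> bool" where
  "banach_space X \<longleftrightarrow> normed_space X \<and> Metric_space.mcomplete (vecs X) (ndist X)"

definition linear_map_between :: "'v::real_vector nspace \<Rightarrow> 'w::real_vector nspace \<Rightarrow> ('v \<Rightarrow> 'w) \<Rightarrow> bool" where
  "linear_map_between X Y T \<longleftrightarrow> T ` vecs X \<subseteq> vecs Y \<and>
     (\<forall>x\<in>vecs X. \<forall>y\<in>vecs X. T (x + y) = T x + T y) \<and>
     (\<forall>c. \<forall>x\<in>vecs X. T (c *\<^sub>R x) = c *\<^sub>R T x)"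

definition bounded_linear_between :: "'v::real_vector nspace \<Rightarrow> 'w::real_vector nspace \<Rightarrow> ('v \<Rightarrow> 'w) \<Rightarrow> bool" where
  "bounded_linear_between X Y T \<longleftrightarrow> linear_map_between X Y T \<and>
     (\<exists>C. \<forall>x\<in>vecs X. nrm Y (T x) \<le> C * nrm X x)"

definition isomorphic_nspaces :: "'v::real_vector nspace \<Rightarrow> 'w::real_vector nspace \<Rightarrow> bool" where
  "isomorphic_nspaces X Y \<longleftrightarrow>
     (\<exists>T. linear_map_between X Y T \<and> homeomorphic_map (ntopology X) (ntopology Y) T)"

definition complemented_subspace :: "'v::real_vector nspace \<Rightarrow> 'v set \<Rightarrow> bool" where
  "complemented_subspace Y M \<longleftrightarrow> subspace M \<and> closedin (ntopology Y) M \<and>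
     (\<exists>P. bounded_linear_between Y Y P \<and> (\<forall>y\<in>vecs Y. P (P y) = P y) \<and> P ` vecs Y = M)"

definition contains_complemented_copy :: "'v::real_vector nspace \<Rightarrow> 'w::real_vector nspace \<Rightarrow> bool" where
  "contains_complemented_copy Y Z \<longleftrightarrow>
     (\<exists>M. complemented_subspace Y M \<and> isomorphic_nspaces Z (Y\<lparr>vecs := M\<rparr>))"

text \<open>Functions on a carrier \<open>A\<close> are represented by total functions that vanish off \<open>A\<close>. The inserted
  0 only matters for \<open>A = {}\<close>.\<close>

definition sup_norm :: "'a set \<Rightarrow> ('b \<Rightarrow> real) \<Rightarrow> ('a \<Rightarrow> 'b) \<Rightarrow> real" where
  "sup_norm A N f = Sup (insert 0 ((\<lambda>x. N (f x)) ` A))"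

definition C_space :: "'k topology \<Rightarrow> 'v::real_vector nspace \<Rightarrow> ('k \<Rightarrow> 'v) nspace" where
  "C_space K X =
     \<lparr>vecs = {f. continuous_map K (ntopology X) f \<and> (\<forall>x. x \<notin> topspace K \<longrightarrow> f x = 0)},
      nrm = sup_norm (topspace K) (nrm X)\<rparr>"

definition c0_space :: "'g set \<Rightarrow> ('g \<Rightarrow> real) nspace" where
  "c0_space \<Gamma> =
     \<lparr>vecs = {f. (\<forall>\<epsilon>>0. finite {\<gamma> \<in> \<Gamma>. \<epsilon> \<le> \<bar>f \<gamma>\<bar>}) \<and> (\<forall>\<gamma>. \<gamma> \<notin> \<Gamma> \<longrightarrow> f \<gamma> = 0)},
      nrm = sup_norm \<Gamma> abs\<rparr>"

end

theory Submission
  imports Defs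
begin

text \<open>Let \<open>D\<close> be a cofinal subset of \<open>\<tau>\<close> of size cf \<open>\<tau>\<close>, let \<open>w \<in> D\<close>, and let \<open>p\<close> send every
  ordinal below \<open>\<tau>\<close> to a strictly larger element of \<open>D - {w}\<close>. The fibres of \<open>p\<close> split \<open>\<tau>\<close> into
  pieces \<open>\<Gamma>\<^sub>i\<close>, each contained in a proper initial segment and hence of size less than \<open>\<tau>\<close>. Take for
  \<open>X\<close> the \<open>l\<^sub>1\<close>-sum of the spaces \<open>c\<^sub>0(\<Gamma>\<^sub>i)\<close> and for \<open>K\<close> the one-point compactification of the
  discrete space \<open>D - {w}\<close>, with \<open>w\<close> as its point at infinity. The weight of \<open>K\<close> is the size of \<open>D\<close>
  (\<open>weight_fort_space\<close>).

  A continuous function on \<open>K\<close> that vanishes at \<open>w\<close> is a null family of vectors of \<open>X\<close>, so \<open>C(K, X)\<close>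
  replaces the summation over \<open>i\<close> in the norm of \<open>X\<close> by a supremum. Putting \<open>c\<^sub>0(\<Gamma>\<^sub>i)\<close> into the
  value at \<open>i\<close> therefore embeds \<open>c\<^sub>0(\<tau>)\<close>, the \<open>c\<^sub>0\<close>-sum of the \<open>c\<^sub>0(\<Gamma>\<^sub>i)\<close>; reading these
  coordinates off again, after subtraction of the value at \<open>w\<close>, gives a bounded left inverse
  (\<open>C_space_fort_space_contains_complemented_c0\<close>).

  The space \<open>X\<close> contains no isomorphic copy of \<open>c\<^sub>0(\<tau>)\<close> at all. Let \<open>T\<close> be an embedding. In \<open>c\<^sub>0\<close>
  a signed sum of distinct unit vectors has norm at most one, whereas in an \<open>l\<^sub>1\<close>-sum contributions
  from different summands add up. Hence, up to finitely many unit vectors, the images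
  \<open>T e\<^sub>\<gamma>\<close> are uniformly small outside finitely many summands (\<open>uniformly_small_tails\<close>), and all
  these \<open>T e\<^sub>\<gamma>\<close> have a coordinate of size at least some constant within those summands. By the same
  use of signs a single coordinate serves only finitely many \<open>\<gamma>\<close>
  (\<open>finite_large_coordinates\<close>), so \<open>\<tau>\<close> is covered by finite sets, one of them exceptional and
  the others indexed by the elements of finitely many of the \<open>\<Gamma>\<^sub>i\<close>. As a finite union of the \<open>\<Gamma>\<^sub>i\<close> has fewer than
  \<open>\<tau>\<close> elements, this is impossible (\<open>l1_sum_c0_not_contains_c0\<close>).\<close>

section \<open>Normed spaces and complemented copies\<close>

lemma
  assumes "normed_space X"
  shows nspace_add: "x \<in> vecs X \<Longrightarrow> y \<in> vecs X \<Longrightarrow> x + y \<in> vecs X"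
    and nspace_diff: "x \<in> vecs X \<Longrightarrow> y \<in> vecs X \<Longrightarrow> x - y \<in> vecs X"
    and nspace_scale: "x \<in> vecs X \<Longrightarrow> c *\<^sub>R x \<in> vecs X"
    and nspace_zero: "0 \<in> vecs X"
    and nrm_nonneg: "x \<in> vecs X \<Longrightarrow> 0 \<le> nrm X x"
    and nrm_eq_0: "x \<in> vecs X \<Longrightarrow> nrm X x = 0 \<longleftrightarrow> x = 0"
    and nrm_scale: "x \<in> vecs X \<Longrightarrow> nrm X (c *\<^sub>R x) = \<bar>c\<bar> * nrm X x"
    and nrm_triangle: "x \<in> vecs X \<Longrightarrow> y \<in> vecs X \<Longrightarrow> nrm X (x + y) \<le> nrm X x + nrm X y"
  using assms unfolding normed_space_def
  by (auto intro: subspace_add subspace_diff subspace_scale subspace_0)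

lemma nrm_zero: "normed_space X \<Longrightarrow> nrm X 0 = 0"
  using nrm_eq_0 nspace_zero by blast

lemma nrm_minus_commute:
  assumes "normed_space X" "x \<in> vecs X" "y \<in> vecs X"
  shows "nrm X (x - y) = nrm X (y - x)"
  using nrm_scale[OF assms(1) nspace_diff[OF assms(1,3,2)], of "-1"] by simp

lemma nrm_triangle_diff:
  assumes "normed_space X" "x \<in> vecs X" "y \<in> vecs X"
  shows "nrm X x \<le> nrm X y + nrm X (x - y)"
  using nrm_triangle[OF assms(1,3) nspace_diff[OF assms]] by simp

lemma topspace_ntopology:
  assumes "normed_space X"
  shows "topspace (ntopology X) = vecs X"
  using Metric_space.topspace_mtopology[OF Metric_space_ndist[OF assms]]
  by (simp add: ntopology_def)

lemma normed_space_subspace: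
  assumes "normed_space X" "subspace M" "M \<subseteq> vecs X"
  shows "normed_space (X\<lparr>vecs := M\<rparr>)"
  using assms unfolding normed_space_def by (simp add: subset_iff)

lemma continuous_map_ntopology_iff:
  assumes "normed_space X" "normed_space Y"
  shows "continuous_map (ntopology X) (ntopology Y) f \<longleftrightarrow> f ` vecs X \<subseteq> vecs Y \<and>
    (\<forall>a\<in>vecs X. \<forall>\<epsilon>>0. \<exists>\<delta>>0. \<forall>x\<in>vecs X. nrm X (a - x) < \<delta> \<longrightarrow> nrm Y (f a - f x) < \<epsilon>)"
proof -
  have "continuous_map (ntopology X) (ntopology Y) f \<longleftrightarrow> f ` vecs X \<subseteq> vecs Y \<and>
    (\<forall>a\<in>vecs X. \<forall>\<epsilon>>0. \<exists>\<delta>>0. \<forall>x. x \<in> vecs X \<and> ndist X a x < \<delta> \<longrightarrow> ndist Y (f a) (f x) < \<epsilon>)"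
    unfolding ntopology_def
    by (rule Metric_space.metric_continuous_map[OF Metric_space_ndist[OF assms(1)]
          Metric_space_ndist[OF assms(2)]])
  also have "\<dots> \<longleftrightarrow> f ` vecs X \<subseteq> vecs Y \<and>
    (\<forall>a\<in>vecs X. \<forall>\<epsilon>>0. \<exists>\<delta>>0. \<forall>x\<in>vecs X. nrm X (a - x) < \<delta> \<longrightarrow> nrm Y (f a - f x) < \<epsilon>)"
    by (rule conj_cong[OF refl], rule ball_cong[OF refl])
       (simp add: ndist_def image_subset_iff Ball_def conj_imp_eq_imp_imp cong: imp_cong)
  finally show ?thesis .
qed

lemma continuous_map_into_ntopology_iff:
  assumes "normed_space X"
  shows "continuous_map K (ntopology X) f \<longleftrightarrow> f ` topspace K \<subseteq> vecs X \<and>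
    (\<forall>x\<in>topspace K. \<forall>\<epsilon>>0. \<exists>U. openin K U \<and> x \<in> U \<and> (\<forall>y\<in>U. nrm X (f y - f x) < \<epsilon>))"
proof -
  interpret X: Metric_space "vecs X" "ndist X"
    by (rule Metric_space_ndist[OF assms])
  have *: "f y \<in> X.mball (f x) \<epsilon> \<longleftrightarrow> nrm X (f y - f x) < \<epsilon>"
    if "f ` topspace K \<subseteq> vecs X" "x \<in> topspace K" "y \<in> topspace K" for x y \<epsilon>
    using that nrm_minus_commute[OF assms] by (auto simp: X.in_mball ndist_def image_subset_iff)
  have "f ` topspace K \<subseteq> vecs X" if "continuous_map K (ntopology X) f"
    using continuous_map_image_subset_topspace[OF that] by (simp add: topspace_ntopology[OF assms])
  moreover have "continuous_map K (ntopology X) f \<longleftrightarrow>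
     (\<forall>x\<in>topspace K. \<forall>\<epsilon>>0. \<exists>U. openin K U \<and> x \<in> U \<and> (\<forall>y\<in>U. nrm X (f y - f x) < \<epsilon>))"
    if "f ` topspace K \<subseteq> vecs X"
    unfolding ntopology_def X.continuous_map_to_metric
    using *[OF that] by (meson openin_subset subsetD)
  ultimately show ?thesis
    by blast
qed

lemma linear_map_between_zero:
  assumes "normed_space X" "linear_map_between X Y T"
  shows "T 0 = 0"
  using assms(2) nspace_zero[OF assms(1)] unfolding linear_map_between_def
  by (metis scaleR_zero_left)

lemma linear_map_between_diff:
  assumes "normed_space X" "linear_map_between X Y T" "x \<in> vecs X" "y \<in> vecs X"
  shows "T (x - y) = T x - T y"
proof -
  have "T (x + (-1) *\<^sub>R y) = T x + (-1) *\<^sub>R T y"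
    using assms nspace_scale[OF assms(1,4), of "-1"] unfolding linear_map_between_def by metis
  thus ?thesis
    by simp
qed

text \<open>The constant in the definition of boundedness may be zero or, on a trivial space, negative;
  its maximum with 1 can serve as a divisor.\<close>

lemma bounded_linear_between_obtain:
  assumes "normed_space X" "bounded_linear_between X Y T"
  obtains C where "C > 0" "\<And>x. x \<in> vecs X \<Longrightarrow> nrm Y (T x) \<le> C * nrm X x"
proof -
  from assms(2) obtain C where C: "\<And>x. x \<in> vecs X \<Longrightarrow> nrm Y (T x) \<le> C * nrm X x"
    unfolding bounded_linear_between_def by blast
  have "nrm Y (T x) \<le> max C 1 * nrm X x" if "x \<in> vecs X" for x
    using C[OF that] nrm_nonneg[OF assms(1) that]
    by (meson max.cobounded1 mult_right_mono order_trans)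
  thus thesis
    by (intro that[of "max C 1"]) auto
qed

lemma bounded_linear_between_imp_continuous_map:
  assumes "normed_space X" "normed_space Y" "bounded_linear_between X Y T"
  shows "continuous_map (ntopology X) (ntopology Y) T"
proof -
  have lin: "linear_map_between X Y T"
    using assms(3) by (simp add: bounded_linear_between_def)
  obtain C where C: "C > 0" "\<And>x. x \<in> vecs X \<Longrightarrow> nrm Y (T x) \<le> C * nrm X x"
    using bounded_linear_between_obtain[OF assms(1,3)] by blast
  have "\<exists>\<delta>>0. \<forall>x\<in>vecs X. nrm X (a - x) < \<delta> \<longrightarrow> nrm Y (T a - T x) < \<epsilon>"
    if a: "a \<in> vecs X" and "\<epsilon> > 0" for a \<epsilon>
  proof (intro exI[of _ "\<epsilon> / C"] conjI ballI impI)
    show "\<epsilon> / C > 0"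
      using C(1) that by simp
    fix x assume x: "x \<in> vecs X" "nrm X (a - x) < \<epsilon> / C"
    have "nrm Y (T a - T x) = nrm Y (T (a - x))"
      using linear_map_between_diff[OF assms(1) lin a x(1)] by simp
    also have "\<dots> \<le> C * nrm X (a - x)"
      using C(2) nspace_diff[OF assms(1) a x(1)] by blast
    also have "\<dots> < \<epsilon>"
      using x(2) C(1) by (simp add: field_simps)
    finally show "nrm Y (T a - T x) < \<epsilon>" .
  qed
  thus ?thesis
    using lin unfolding continuous_map_ntopology_iff[OF assms(1,2)] linear_map_between_def by blast
qed

lemma continuous_linear_map_bounded:
  assumes X: "normed_space X" and Y: "normed_space Y" and lin: "linear_map_between X Y T"
    and cont: "continuous_map (ntopology X) (ntopology Y) T"
  shows "bounded_linear_between X Y T"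
proof -
  have "\<forall>\<epsilon>>0. \<exists>\<delta>>0. \<forall>x\<in>vecs X. nrm X (0 - x) < \<delta> \<longrightarrow> nrm Y (T 0 - T x) < \<epsilon>"
    using cont nspace_zero[OF X] unfolding continuous_map_ntopology_iff[OF X Y] by blast
  then obtain \<delta> where \<delta>: "\<delta> > 0" "\<forall>x\<in>vecs X. nrm X (0 - x) < \<delta> \<longrightarrow> nrm Y (T 0 - T x) < 1"
    by (meson zero_less_one)
  have small: "nrm Y (T x) < 1" if "x \<in> vecs X" "nrm X x < \<delta>" for x
  proof -
    have "nrm Y (T 0 - T (0 - x)) < 1"
      using \<delta>(2) nspace_diff[OF X nspace_zero[OF X] that(1)] that(2) by simp
    thus ?thesis
      using linear_map_between_diff[OF X lin nspace_zero[OF X] that(1)] linear_map_between_zero[OF X lin]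
      by simp
  qed
  have "nrm Y (T x) \<le> (2 / \<delta>) * nrm X x" if x: "x \<in> vecs X" for x
  proof (cases "x = 0")
    case True
    thus ?thesis
      by (simp add: linear_map_between_zero[OF X lin] nrm_zero[OF X] nrm_zero[OF Y])
  next
    case False
    hence pos: "nrm X x > 0"
      using nrm_nonneg[OF X x] nrm_eq_0[OF X x] by linarith
    define c where "c = \<delta> / (2 * nrm X x)"
    have c: "c > 0"
      using pos \<delta>(1) by (simp add: c_def)
    have Tx: "T x \<in> vecs Y"
      using lin x unfolding linear_map_between_def by blast
    have "nrm X (c *\<^sub>R x) = \<delta> / 2"
      using pos c \<delta>(1) by (simp add: nrm_scale[OF X x] c_def)
    hence "nrm Y (T (c *\<^sub>R x)) < 1"
      using small[OF nspace_scale[OF X x]] \<delta>(1) by simp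
    moreover have "T (c *\<^sub>R x) = c *\<^sub>R T x"
      using lin x unfolding linear_map_between_def by blast
    ultimately have "c * nrm Y (T x) < 1"
      using c by (simp add: nrm_scale[OF Y Tx])
    thus ?thesis
      using c pos \<delta>(1) by (simp add: c_def field_simps)
  qed
  thus ?thesis
    using lin unfolding bounded_linear_between_def by blast
qed

text \<open>A bounded left inverse \<open>Q\<close> of \<open>J\<close> gives everything at once: \<open>J \<circ> Q\<close> is the projection, its
  range is closed as the set where it agrees with the identity, and \<open>Q\<close> restricts to the inverse
  of \<open>J\<close>.\<close>

lemma contains_complemented_copyI:
  assumes Y: "normed_space Y" and Z: "normed_space Z"
    and J: "bounded_linear_between Z Y J" and Q: "bounded_linear_between Y Z Q"
    and QJ: "\<And>z. z \<in> vecs Z \<Longrightarrow> Q (J z) = z"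
  shows "contains_complemented_copy Y Z"
proof -
  define M where "M = J ` vecs Z"
  have linJ: "linear_map_between Z Y J" and linQ: "linear_map_between Y Z Q"
    using J Q by (simp_all add: bounded_linear_between_def)
  have JY: "J z \<in> vecs Y" if "z \<in> vecs Z" for z
    using linJ that unfolding linear_map_between_def by blast
  have QZ: "Q y \<in> vecs Z" if "y \<in> vecs Y" for y
    using linQ that unfolding linear_map_between_def by blast
  have "subspace M"
    unfolding subspace_def
  proof (intro conjI ballI allI)
    show "0 \<in> M"
      using linear_map_between_zero[OF Z linJ] nspace_zero[OF Z] by (metis M_def imageI)
    fix x y assume "x \<in> M" "y \<in> M"
    then obtain a b where "x = J a" "y = J b" "a \<in> vecs Z" "b \<in> vecs Z"
      by (auto simp: M_def)
    thus "x + y \<in> M"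
      using linJ nspace_add[OF Z] unfolding linear_map_between_def M_def by (metis imageI)
  next
    fix x c assume "x \<in> M"
    then obtain a where "x = J a" "a \<in> vecs Z"
      by (auto simp: M_def)
    thus "c *\<^sub>R x \<in> M"
      using linJ nspace_scale[OF Z] unfolding linear_map_between_def M_def by (metis imageI)
  qed
  have MY: "M \<subseteq> vecs Y"
    using JY by (auto simp: M_def)
  define P where "P = J \<circ> Q"
  obtain C where C: "C > 0" "\<And>z. z \<in> vecs Z \<Longrightarrow> nrm Y (J z) \<le> C * nrm Z z"
    using bounded_linear_between_obtain[OF Z J] by blast
  obtain D where D: "D > 0" "\<And>y. y \<in> vecs Y \<Longrightarrow> nrm Z (Q y) \<le> D * nrm Y y"
    using bounded_linear_between_obtain[OF Y Q] by blast
  have P: "bounded_linear_between Y Y P"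
    unfolding bounded_linear_between_def linear_map_between_def
  proof (intro conjI ballI allI exI[of _ "C * D"])
    show "P ` vecs Y \<subseteq> vecs Y"
      using JY QZ by (auto simp: P_def)
    show "P (x + y) = P x + P y" if "x \<in> vecs Y" "y \<in> vecs Y" for x y
      using that linJ linQ QZ by (simp add: P_def linear_map_between_def)
    show "P (c *\<^sub>R x) = c *\<^sub>R P x" if "x \<in> vecs Y" for c x
      using that linJ linQ QZ by (simp add: P_def linear_map_between_def)
    show "nrm Y (P x) \<le> C * D * nrm Y x" if "x \<in> vecs Y" for x
    proof -
      have "nrm Y (P x) \<le> C * nrm Z (Q x)"
        using C(2) QZ that by (simp add: P_def)
      also have "\<dots> \<le> C * (D * nrm Y x)"
        using D(2) that C(1) by (intro mult_left_mono) auto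
      finally show ?thesis
        by simp
    qed
  qed
  have "P ` vecs Y = M"
  proof
    show "P ` vecs Y \<subseteq> M"
      using QZ by (auto simp: P_def M_def)
    show "M \<subseteq> P ` vecs Y"
    proof
      fix m assume "m \<in> M"
      then obtain z where "m = J z" "z \<in> vecs Z"
        by (auto simp: M_def)
      thus "m \<in> P ` vecs Y"
        using QJ JY by (intro image_eqI[of _ _ "J z"]) (auto simp: P_def)
    qed
  qed
  moreover have "P (P y) = P y" if "y \<in> vecs Y" for y
    using QJ QZ that by (simp add: P_def)
  moreover have "closedin (ntopology Y) M"
  proof -
    have "closedin (ntopology Y) {y \<in> topspace (ntopology Y). P y = id y}"
      using bounded_linear_between_imp_continuous_map[OF Y Y P]
        Metric_space.Hausdorff_space_mtopology[OF Metric_space_ndist[OF Y]]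
      by (intro closedin_continuous_maps_eq[of "ntopology Y"] continuous_map_id)
         (simp_all add: ntopology_def)
    moreover have "{y \<in> topspace (ntopology Y). P y = id y} = M"
      using QJ JY QZ by (auto simp: topspace_ntopology[OF Y] P_def M_def) (metis imageI)
    ultimately show ?thesis
      by simp
  qed
  ultimately have "complemented_subspace Y M"
    using \<open>subspace M\<close> P unfolding complemented_subspace_def by blast
  moreover have "isomorphic_nspaces Z (Y\<lparr>vecs := M\<rparr>)"
  proof -
    have N: "normed_space (Y\<lparr>vecs := M\<rparr>)"
      by (rule normed_space_subspace[OF Y \<open>subspace M\<close> MY])
    have J': "bounded_linear_between Z (Y\<lparr>vecs := M\<rparr>) J"
      using J unfolding bounded_linear_between_def linear_map_between_def M_def by simp
    have Q': "bounded_linear_between (Y\<lparr>vecs := M\<rparr>) Z Q"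
      using Q MY unfolding bounded_linear_between_def linear_map_between_def
      by (simp add: subset_iff image_subset_iff) blast
    have "homeomorphic_maps (ntopology Z) (ntopology (Y\<lparr>vecs := M\<rparr>)) J Q"
      unfolding homeomorphic_maps_def topspace_ntopology[OF Z] topspace_ntopology[OF N]
      using bounded_linear_between_imp_continuous_map[OF Z N J']
        bounded_linear_between_imp_continuous_map[OF N Z Q'] QJ
      by (auto simp: M_def)
    hence "homeomorphic_map (ntopology Z) (ntopology (Y\<lparr>vecs := M\<rparr>)) J"
      by (metis homeomorphic_map_maps)
    thus ?thesis
      using J' unfolding isomorphic_nspaces_def bounded_linear_between_def by blast
  qed
  ultimately show ?thesis
    unfolding contains_complemented_copy_def by blast
qed

text \<open>A linear homeomorphism onto a subspace is bounded, and so is its inverse; the bound for the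
  inverse is the lower estimate.\<close>

lemma contains_complemented_copyE:
  assumes Y: "normed_space Y" and Z: "normed_space Z" and "contains_complemented_copy Y Z"
  obtains T \<delta> where "bounded_linear_between Z Y T" "\<delta> > 0"
    "\<And>z. z \<in> vecs Z \<Longrightarrow> \<delta> * nrm Z z \<le> nrm Y (T z)"
proof -
  obtain M T where M: "complemented_subspace Y M"
    and T: "linear_map_between Z (Y\<lparr>vecs := M\<rparr>) T"
    and hom: "homeomorphic_map (ntopology Z) (ntopology (Y\<lparr>vecs := M\<rparr>)) T"
    using assms(3) unfolding contains_complemented_copy_def isomorphic_nspaces_def by blast
  have MY: "M \<subseteq> vecs Y" and "subspace M"
    using M unfolding complemented_subspace_def bounded_linear_between_def linear_map_between_def
    by blast+
  let ?N = "Y\<lparr>vecs := M\<rparr>"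
  have N: "normed_space ?N"
    by (rule normed_space_subspace[OF Y \<open>subspace M\<close> MY])
  obtain S where TS: "homeomorphic_maps (ntopology Z) (ntopology ?N) T S"
    using hom by (metis homeomorphic_map_maps)
  have cont: "continuous_map (ntopology Z) (ntopology ?N) T"
    "continuous_map (ntopology ?N) (ntopology Z) S"
    and ST: "\<And>z. z \<in> vecs Z \<Longrightarrow> S (T z) = z" and "\<And>y. y \<in> M \<Longrightarrow> T (S y) = y"
    using TS unfolding homeomorphic_maps_def topspace_ntopology[OF Z] topspace_ntopology[OF N]
    by auto
  note TS = this(4)
  have SZ: "S y \<in> vecs Z" if "y \<in> M" for y
    using cont(2) that unfolding continuous_map_ntopology_iff[OF N Z] by auto
  have "linear_map_between ?N Z S"
    unfolding linear_map_between_def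
  proof (intro conjI ballI allI)
    show "S ` vecs ?N \<subseteq> vecs Z"
      using SZ by auto
    fix x assume "x \<in> vecs ?N"
    hence x: "x \<in> M"
      by simp
    have "S (x + y) = S (T (S x + S y))" if "y \<in> M" for y
      using T SZ TS x that unfolding linear_map_between_def by simp
    thus "S (x + y) = S x + S y" if "y \<in> vecs ?N" for y
      using ST SZ x that nspace_add[OF Z] by simp
    have "S (c *\<^sub>R x) = S (T (c *\<^sub>R S x))" for c
      using T SZ TS x unfolding linear_map_between_def by simp
    thus "S (c *\<^sub>R x) = c *\<^sub>R S x" for c
      using ST SZ x nspace_scale[OF Z] by simp
  qed
  hence "bounded_linear_between ?N Z S"
    using continuous_linear_map_bounded[OF N Z] cont(2) by blast
  then obtain C where C: "C > 0" "\<And>y. y \<in> M \<Longrightarrow> nrm Z (S y) \<le> C * nrm Y y"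
    using bounded_linear_between_obtain[OF N] by (metis nspace.select_convs nspace.surjective nspace.update_convs(1))
  have "1 / C * nrm Z z \<le> nrm Y (T z)" if "z \<in> vecs Z" for z
  proof -
    have "T z \<in> M"
      using T that unfolding linear_map_between_def by auto
    from C(2)[OF this] show ?thesis
      using ST[OF that] C(1) by (simp add: field_simps)
  qed
  moreover have "bounded_linear_between Z Y T"
    using continuous_linear_map_bounded[OF Z N T cont(1)] MY
    unfolding bounded_linear_between_def linear_map_between_def by auto
  ultimately show thesis
    using that[of T "1 / C"] C(1) by simp
qed


section \<open>Supremum norms\<close>

lemma sup_norm_upper:
  assumes "bdd_above ((\<lambda>x. N (f x)) ` A)" "x \<in> A"
  shows "N (f x) \<le> sup_norm A N f"
  unfolding sup_norm_def using assms by (intro cSup_upper) auto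

lemma sup_norm_least:
  assumes "0 \<le> c" "\<And>x. x \<in> A \<Longrightarrow> N (f x) \<le> c"
  shows "sup_norm A N f \<le> c"
  unfolding sup_norm_def using assms by (intro cSup_least) auto

text \<open>The norms of \<open>c\<^sub>0(\<Gamma>)\<close>, of \<open>C(K, X)\<close> and of the \<open>l\<^sub>1\<close>-sum below are all suprema of a
  separating family of seminorms, so the norm axioms are checked once here.\<close>

lemma normed_space_Sup_seminorms:
  fixes V :: "'v::real_vector set" and \<rho> :: "'i \<Rightarrow> 'v \<Rightarrow> real"
  assumes V: "subspace V"
    and scale: "\<And>i c x. i \<in> I \<Longrightarrow> x \<in> V \<Longrightarrow> \<rho> i (c *\<^sub>R x) = \<bar>c\<bar> * \<rho> i x"
    and triangle: "\<And>i x y. i \<in> I \<Longrightarrow> x \<in> V \<Longrightarrow> y \<in> V \<Longrightarrow> \<rho> i (x + y) \<le> \<rho> i x + \<rho> i y"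
    and bdd: "\<And>x. x \<in> V \<Longrightarrow> bdd_above ((\<lambda>i. \<rho> i x) ` I)"
    and sep: "\<And>x. x \<in> V \<Longrightarrow> (\<And>i. i \<in> I \<Longrightarrow> \<rho> i x \<le> 0) \<Longrightarrow> x = 0"
  shows "normed_space \<lparr>vecs = V, nrm = (\<lambda>x. Sup (insert 0 ((\<lambda>i. \<rho> i x) ` I)))\<rparr>"
proof -
  define n where "n x = Sup (insert 0 ((\<lambda>i. \<rho> i x) ` I))" for x
  have upper: "\<rho> i x \<le> n x" if "x \<in> V" "i \<in> I" for i x
    unfolding n_def using bdd that by (intro cSup_upper) auto
  have nonneg: "0 \<le> n x" if "x \<in> V" for x
    unfolding n_def using bdd that by (intro cSup_upper) auto
  have least: "n x \<le> c" if "0 \<le> c" "\<And>i. i \<in> I \<Longrightarrow> \<rho> i x \<le> c" for x c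
    unfolding n_def using that by (intro cSup_least) auto
  have cV: "c *\<^sub>R x \<in> V" if "x \<in> V" for c x
    using V that by (rule subspace_scale)
  have le: "n (c *\<^sub>R x) \<le> \<bar>c\<bar> * n x" if "x \<in> V" for c x
    using upper[OF that] nonneg[OF that]
    by (intro least) (simp_all add: scale[OF _ that] mult_left_mono)
  have "n (c *\<^sub>R x) = \<bar>c\<bar> * n x" if x: "x \<in> V" for c x
  proof (cases "c = 0")
    case True
    thus ?thesis
      using le[OF x, of 0] nonneg[OF cV[OF x], of 0] by simp
  next
    case False
    have "n x \<le> \<bar>inverse c\<bar> * n (c *\<^sub>R x)"
      using le[OF cV[OF x, of c], of "inverse c"] False by simp
    hence "\<bar>c\<bar> * n x \<le> n (c *\<^sub>R x)"
      using False by (simp add: field_simps)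
    thus ?thesis
      using le[OF x, of c] by simp
  qed
  moreover have "n (x + y) \<le> n x + n y" if "x \<in> V" "y \<in> V" for x y
  proof (rule least)
    show "\<rho> i (x + y) \<le> n x + n y" if "i \<in> I" for i
      using triangle[OF that \<open>x \<in> V\<close> \<open>y \<in> V\<close>] upper[OF \<open>x \<in> V\<close> that] upper[OF \<open>y \<in> V\<close> that]
      by linarith
  qed (use nonneg that in auto)
  moreover have "n x = 0 \<longleftrightarrow> x = 0" if "x \<in> V" for x
  proof
    assume "n x = 0"
    thus "x = 0"
      using upper[OF that] by (intro sep[OF that]) simp
  next
    assume "x = 0"
    thus "n x = 0"
      using le[OF that, of 0] nonneg[OF that] by simp
  qed
  ultimately show ?thesis
    using V nonneg unfolding normed_space_def n_def[symmetric] by simp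
qed

lemma in_c0_space_iff:
  "f \<in> vecs (c0_space \<Gamma>) \<longleftrightarrow>
     (\<forall>\<epsilon>>0. finite {\<gamma> \<in> \<Gamma>. \<epsilon> \<le> \<bar>f \<gamma>\<bar>}) \<and> (\<forall>\<gamma>. \<gamma> \<notin> \<Gamma> \<longrightarrow> f \<gamma> = 0)"
  by (simp add: c0_space_def)

lemma bdd_above_c0_space:
  assumes "f \<in> vecs (c0_space \<Gamma>)"
  shows "bdd_above ((\<lambda>\<gamma>. \<bar>f \<gamma>\<bar>) ` \<Gamma>)"
proof -
  have "finite {\<gamma> \<in> \<Gamma>. 1 \<le> \<bar>f \<gamma>\<bar>}"
    using assms unfolding in_c0_space_iff by (meson zero_less_one)
  hence "bdd_above ((\<lambda>\<gamma>. \<bar>f \<gamma>\<bar>) ` {\<gamma> \<in> \<Gamma>. 1 \<le> \<bar>f \<gamma>\<bar>} \<union> {..1})"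
    by (simp add: bdd_above_finite)
  thus ?thesis
    by (rule bdd_above_mono) auto
qed

lemma subspace_c0_space: "subspace (vecs (c0_space \<Gamma>))"
  unfolding subspace_def
proof (intro conjI ballI allI)
  show "0 \<in> vecs (c0_space \<Gamma>)"
    by (auto simp: in_c0_space_iff)
  fix f g assume f: "f \<in> vecs (c0_space \<Gamma>)"
  {
    assume g: "g \<in> vecs (c0_space \<Gamma>)"
    have "finite {\<gamma> \<in> \<Gamma>. \<epsilon> \<le> \<bar>(f + g) \<gamma>\<bar>}" if "\<epsilon> > 0" for \<epsilon>
    proof (rule finite_subset)
      show "finite ({\<gamma> \<in> \<Gamma>. \<epsilon> / 2 \<le> \<bar>f \<gamma>\<bar>} \<union> {\<gamma> \<in> \<Gamma>. \<epsilon> / 2 \<le> \<bar>g \<gamma>\<bar>})"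
        using f g half_gt_zero[OF that] unfolding in_c0_space_iff by blast
    qed auto
    thus "f + g \<in> vecs (c0_space \<Gamma>)"
      using f g by (simp add: in_c0_space_iff)
  }
  fix c :: real
  have "finite {\<gamma> \<in> \<Gamma>. \<epsilon> \<le> \<bar>(c *\<^sub>R f) \<gamma>\<bar>}" if "\<epsilon> > 0" for \<epsilon>
  proof (cases "c = 0")
    case False
    hence "{\<gamma> \<in> \<Gamma>. \<epsilon> \<le> \<bar>(c *\<^sub>R f) \<gamma>\<bar>} = {\<gamma> \<in> \<Gamma>. \<epsilon> / \<bar>c\<bar> \<le> \<bar>f \<gamma>\<bar>}"
      by (auto simp: scaleR_fun_def abs_mult field_simps)
    thus ?thesis
      using f that False by (simp add: in_c0_space_iff)
  qed (use that in \<open>simp add: scaleR_fun_def\<close>)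
  thus "c *\<^sub>R f \<in> vecs (c0_space \<Gamma>)"
    using f by (simp add: in_c0_space_iff scaleR_fun_def)
qed

lemma c0_space_dominated:
  assumes "f \<in> vecs (c0_space \<Gamma>)" "\<And>\<gamma>. \<bar>g \<gamma>\<bar> \<le> \<bar>f \<gamma>\<bar>"
  shows "g \<in> vecs (c0_space \<Gamma>)"
  unfolding in_c0_space_iff
proof (intro conjI allI impI)
  show "finite {\<gamma> \<in> \<Gamma>. \<epsilon> \<le> \<bar>g \<gamma>\<bar>}" if "\<epsilon> > 0" for \<epsilon>
  proof (rule finite_subset)
    show "finite {\<gamma> \<in> \<Gamma>. \<epsilon> \<le> \<bar>f \<gamma>\<bar>}"
      using assms(1) that by (simp add: in_c0_space_iff)
  qed (use assms(2) in \<open>auto intro: order_trans\<close>)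
  show "g \<gamma> = 0" if "\<gamma> \<notin> \<Gamma>" for \<gamma>
    using assms(1) assms(2)[of \<gamma>] that by (simp add: in_c0_space_iff)
qed

lemma normed_space_c0_space: "normed_space (c0_space \<Gamma>)"
proof -
  have "normed_space \<lparr>vecs = vecs (c0_space \<Gamma>),
      nrm = (\<lambda>f. Sup (insert 0 ((\<lambda>\<gamma>. \<bar>f \<gamma>\<bar>) ` \<Gamma>)))\<rparr>"
  proof (rule normed_space_Sup_seminorms[OF subspace_c0_space])
    show "f = 0" if "f \<in> vecs (c0_space \<Gamma>)" "\<And>\<gamma>. \<gamma> \<in> \<Gamma> \<Longrightarrow> \<bar>f \<gamma>\<bar> \<le> 0" for f
      using that by (auto simp: in_c0_space_iff fun_eq_iff)
  qed (auto simp: scaleR_fun_def abs_mult bdd_above_c0_space)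
  thus ?thesis
    by (simp add: c0_space_def sup_norm_def[abs_def])
qed

lemma abs_le_nrm_c0:
  assumes "f \<in> vecs (c0_space \<Gamma>)"
  shows "\<bar>f \<gamma>\<bar> \<le> nrm (c0_space \<Gamma>) f"
proof (cases "\<gamma> \<in> \<Gamma>")
  case True
  thus ?thesis
    using sup_norm_upper[where N = abs and f = f, OF bdd_above_c0_space[OF assms]] by (simp add: c0_space_def)
next
  case False
  thus ?thesis
    using assms nrm_nonneg[OF normed_space_c0_space assms] by (simp add: in_c0_space_iff)
qed

lemma nrm_c0_le:
  assumes "0 \<le> c" "\<And>\<gamma>. \<gamma> \<in> \<Gamma> \<Longrightarrow> \<bar>f \<gamma>\<bar> \<le> c"
  shows "nrm (c0_space \<Gamma>) f \<le> c"
  using sup_norm_least[of c \<Gamma> abs f] assms by (simp add: c0_space_def)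

lemma finite_support_in_c0_space:
  assumes "finite {\<gamma>. f \<gamma> \<noteq> 0}" "\<And>\<gamma>. \<gamma> \<notin> \<Gamma> \<Longrightarrow> f \<gamma> = 0"
  shows "f \<in> vecs (c0_space \<Gamma>)"
  unfolding in_c0_space_iff using assms by (auto intro: finite_subset[OF _ assms(1)])


section \<open>Spaces of continuous vector-valued functions\<close>

lemma in_C_space_iff:
  assumes "normed_space X"
  shows "f \<in> vecs (C_space K X) \<longleftrightarrow> (\<forall>x. x \<notin> topspace K \<longrightarrow> f x = 0) \<and> range f \<subseteq> vecs X \<and>
    (\<forall>x\<in>topspace K. \<forall>\<epsilon>>0. \<exists>U. openin K U \<and> x \<in> U \<and> (\<forall>y\<in>U. nrm X (f y - f x) < \<epsilon>))"
proof -
  have "range f \<subseteq> vecs X \<longleftrightarrow> f ` topspace K \<subseteq> vecs X" if "\<forall>x. x \<notin> topspace K \<longrightarrow> f x = 0"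
    using that nspace_zero[OF assms] by (metis image_subset_iff UNIV_I)
  thus ?thesis
    unfolding C_space_def nspace.simps mem_Collect_eq continuous_map_into_ntopology_iff[OF assms]
    by blast
qed

lemma bdd_above_C_space:
  assumes X: "normed_space X" and K: "compact_space K" and f: "f \<in> vecs (C_space K X)"
  shows "bdd_above ((\<lambda>x. nrm X (f x)) ` topspace K)"
proof -
  interpret X: Metric_space "vecs X" "ndist X"
    by (rule Metric_space_ndist[OF X])
  have fX: "f x \<in> vecs X" for x
    using f unfolding in_C_space_iff[OF X] by blast
  have "compactin (ntopology X) (f ` topspace K)"
    using f K by (auto simp: C_space_def compact_space_def intro: image_compactin)
  hence "X.mbounded (f ` topspace K)"
    unfolding ntopology_def by (rule X.compactin_imp_mbounded)
  then obtain B where B: "\<And>x y. x \<in> topspace K \<Longrightarrow> y \<in> topspace K \<Longrightarrow> ndist X (f x) (f y) \<le> B"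
    unfolding X.mbounded_alt by blast
  show ?thesis
  proof (cases "topspace K = {}")
    case False
    then obtain y where y: "y \<in> topspace K"
      by blast
    have "nrm X (f x) \<le> nrm X (f y) + B" if "x \<in> topspace K" for x
      using nrm_triangle_diff[OF X fX[of x] fX[of y]] B[OF that y] fX by (simp add: ndist_def)
    thus ?thesis
      by (rule bdd_aboveI2)
  qed simp
qed

lemma subspace_C_space:
  assumes X: "normed_space X"
  shows "subspace (vecs (C_space K X))"
  unfolding subspace_def
proof (intro conjI ballI allI)
  show "0 \<in> vecs (C_space K X)"
    using nspace_zero[OF X] nrm_zero[OF X] by (auto simp: in_C_space_iff[OF X])
  fix f g assume f: "f \<in> vecs (C_space K X)"
  have fX: "f x \<in> vecs X" for x
    using f unfolding in_C_space_iff[OF X] by blast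
  {
    assume g: "g \<in> vecs (C_space K X)"
    have gX: "g x \<in> vecs X" for x
      using g unfolding in_C_space_iff[OF X] by blast
    have "\<exists>U. openin K U \<and> x \<in> U \<and> (\<forall>y\<in>U. nrm X ((f + g) y - (f + g) x) < \<epsilon>)"
      if x: "x \<in> topspace K" and \<epsilon>: "\<epsilon> > 0" for x \<epsilon>
    proof -
      have "\<epsilon> / 2 > 0"
        using \<epsilon> by simp
      then obtain U V where UV: "openin K U" "x \<in> U" "\<And>y. y \<in> U \<Longrightarrow> nrm X (f y - f x) < \<epsilon> / 2"
        "openin K V" "x \<in> V" "\<And>y. y \<in> V \<Longrightarrow> nrm X (g y - g x) < \<epsilon> / 2"
        using f g x unfolding in_C_space_iff[OF X] by meson
      have "nrm X ((f + g) y - (f + g) x) < \<epsilon>" if "y \<in> U \<inter> V" for y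
        using nrm_triangle[OF X nspace_diff[OF X fX fX] nspace_diff[OF X gX gX], of y x y x]
          UV(3)[of y] UV(6)[of y] that by (simp add: algebra_simps)
      thus ?thesis
        using UV by (intro exI[of _ "U \<inter> V"]) auto
    qed
    thus "f + g \<in> vecs (C_space K X)"
      using f g nspace_add[OF X fX gX] unfolding in_C_space_iff[OF X] by auto
  }
  fix c :: real
  have "\<exists>U. openin K U \<and> x \<in> U \<and> (\<forall>y\<in>U. nrm X ((c *\<^sub>R f) y - (c *\<^sub>R f) x) < \<epsilon>)"
    if x: "x \<in> topspace K" and \<epsilon>: "\<epsilon> > 0" for x \<epsilon>
  proof -
    have "\<epsilon> / (\<bar>c\<bar> + 1) > 0"
      using \<epsilon> by simp
    then obtain U where U: "openin K U" "x \<in> U" "\<And>y. y \<in> U \<Longrightarrow> nrm X (f y - f x) < \<epsilon> / (\<bar>c\<bar> + 1)"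
      using f x unfolding in_C_space_iff[OF X] by meson
    have "nrm X ((c *\<^sub>R f) y - (c *\<^sub>R f) x) < \<epsilon>" if "y \<in> U" for y
    proof -
      have "nrm X ((c *\<^sub>R f) y - (c *\<^sub>R f) x) = \<bar>c\<bar> * nrm X (f y - f x)"
        using nrm_scale[OF X nspace_diff[OF X fX fX], of c y x]
        by (simp add: scaleR_fun_def scaleR_diff_right)
      also have "\<dots> \<le> (\<bar>c\<bar> + 1) * nrm X (f y - f x)"
        using nrm_nonneg[OF X nspace_diff[OF X fX fX], of y x] by (intro mult_right_mono) auto
      also have "\<dots> < \<epsilon>"
        using U(3)[OF that] by (simp add: field_simps)
      finally show ?thesis .
    qed
    thus ?thesis
      using U by blast
  qed
  thus "c *\<^sub>R f \<in> vecs (C_space K X)"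
    using f nspace_scale[OF X fX] unfolding in_C_space_iff[OF X] by (auto simp: scaleR_fun_def)
qed

lemma normed_space_C_space:
  assumes X: "normed_space X" and K: "compact_space K"
  shows "normed_space (C_space K X)"
proof -
  have fX: "f x \<in> vecs X" if "f \<in> vecs (C_space K X)" for f x
    using that unfolding in_C_space_iff[OF X] by blast
  have "normed_space \<lparr>vecs = vecs (C_space K X),
      nrm = (\<lambda>f. Sup (insert 0 ((\<lambda>x. nrm X (f x)) ` topspace K)))\<rparr>"
  proof (rule normed_space_Sup_seminorms[OF subspace_C_space[OF X]])
    show "f = 0" if f: "f \<in> vecs (C_space K X)" and "\<And>x. x \<in> topspace K \<Longrightarrow> nrm X (f x) \<le> 0" for f
    proof
      fix x show "f x = 0 x"
      proof (cases "x \<in> topspace K")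
        case True
        thus ?thesis
          using that(2)[OF True] nrm_nonneg[OF X fX[OF f]] nrm_eq_0[OF X fX[OF f]]
          by (metis order_antisym zero_fun_def)
      qed (use f in \<open>simp add: C_space_def\<close>)
    qed
  qed (use fX in \<open>auto simp: scaleR_fun_def nrm_scale[OF X] nrm_triangle[OF X]
        bdd_above_C_space[OF X K]\<close>)
  thus ?thesis
    by (simp add: C_space_def sup_norm_def[abs_def])
qed

lemma nrm_le_nrm_C_space:
  assumes "normed_space X" "compact_space K" "f \<in> vecs (C_space K X)" "x \<in> topspace K"
  shows "nrm X (f x) \<le> nrm (C_space K X) f"
  using sup_norm_upper[where N = "nrm X" and f = f, OF bdd_above_C_space[OF assms(1-3)] assms(4)]
  by (simp add: C_space_def)

lemma nrm_C_space_le: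
  assumes "0 \<le> c" "\<And>x. x \<in> topspace K \<Longrightarrow> nrm X (f x) \<le> c"
  shows "nrm (C_space K X) f \<le> c"
  using sup_norm_least[of c "topspace K" "nrm X" f] assms by (simp add: C_space_def)


section \<open>The one-point compactification of a discrete space\<close>

definition fort_space :: "'k set \<Rightarrow> 'k \<Rightarrow> 'k topology" where
  "fort_space D w = topology (\<lambda>U. U \<subseteq> D \<and> (w \<in> U \<longrightarrow> finite (D - U)))"

lemma openin_fort_space: "openin (fort_space D w) U \<longleftrightarrow> U \<subseteq> D \<and> (w \<in> U \<longrightarrow> finite (D - U))"
proof -
  have "istopology (\<lambda>U. U \<subseteq> D \<and> (w \<in> U \<longrightarrow> finite (D - U)))"
    unfolding istopology_def
  proof (intro conjI allI impI)
    fix S T assume "S \<subseteq> D \<and> (w \<in> S \<longrightarrow> finite (D - S))" "T \<subseteq> D \<and> (w \<in> T \<longrightarrow> finite (D - T))"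
    thus "S \<inter> T \<subseteq> D" "w \<in> S \<inter> T \<Longrightarrow> finite (D - S \<inter> T)"
      by (auto simp: Diff_Int)
  next
    fix \<K> :: "'a set set" assume *: "\<forall>U\<in>\<K>. U \<subseteq> D \<and> (w \<in> U \<longrightarrow> finite (D - U))"
    thus "\<Union>\<K> \<subseteq> D"
      by blast
    assume "w \<in> \<Union>\<K>"
    then obtain U where "U \<in> \<K>" "w \<in> U"
      by blast
    moreover have "D - \<Union>\<K> \<subseteq> D - U"
      using \<open>U \<in> \<K>\<close> by blast
    ultimately show "finite (D - \<Union>\<K>)"
      using * finite_subset by blast
  qed
  thus ?thesis
    by (simp add: fort_space_def)
qed

lemma topspace_fort_space: "topspace (fort_space D w) = D"
proof
  show "topspace (fort_space D w) \<subseteq> D"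
    using openin_topspace openin_fort_space by metis
  show "D \<subseteq> topspace (fort_space D w)"
    by (rule openin_subset) (simp add: openin_fort_space)
qed

lemma compact_space_fort_space:
  assumes "w \<in> D"
  shows "compact_space (fort_space D w)"
  unfolding compact_space topspace_fort_space
proof (intro allI impI)
  fix \<U> assume *: "(\<forall>U\<in>\<U>. openin (fort_space D w) U) \<and> \<Union>\<U> = D"
  then obtain U where U: "U \<in> \<U>" "w \<in> U"
    using assms by blast
  hence fin: "finite (D - U)"
    using * by (auto simp: openin_fort_space)
  have "\<forall>x\<in>D - U. \<exists>V\<in>\<U>. x \<in> V"
    using * by blast
  then obtain V where V: "\<And>x. x \<in> D - U \<Longrightarrow> V x \<in> \<U> \<and> x \<in> V x"
    by metis
  have "\<Union>(insert U (V ` (D - U))) = D"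
  proof
    show "\<Union>(insert U (V ` (D - U))) \<subseteq> D"
      using * V U by blast
    show "D \<subseteq> \<Union>(insert U (V ` (D - U)))"
      using V by blast
  qed
  thus "\<exists>\<F>. finite \<F> \<and> \<F> \<subseteq> \<U> \<and> \<Union>\<F> = D"
    using fin U V by (intro exI[of _ "insert U (V ` (D - U))"]) auto
qed

lemma Hausdorff_space_fort_space: "Hausdorff_space (fort_space D w)"
proof -
  have iso: "\<exists>U V. openin (fort_space D w) U \<and> openin (fort_space D w) V \<and> x \<in> U \<and> y \<in> V \<and> disjnt U V"
    if "x \<in> D" "y \<in> D" "x \<noteq> y" "x \<noteq> w" for x y
    using that by (intro exI[of _ "{x}"] exI[of _ "D - {x}"])
      (auto simp: openin_fort_space disjnt_def Diff_Diff_Int)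
  show ?thesis
    unfolding Hausdorff_space_def topspace_fort_space
  proof (intro allI impI)
    fix x y assume *: "x \<in> D \<and> y \<in> D \<and> x \<noteq> y"
    show "\<exists>U V. openin (fort_space D w) U \<and> openin (fort_space D w) V \<and> x \<in> U \<and> y \<in> V \<and> disjnt U V"
    proof (cases "x = w")
      case True
      thus ?thesis
        using iso[of y x] * disjnt_sym by blast
    qed (use iso * in blast)
  qed
qed

text \<open>Every neighbourhood base at the point at infinity consists of complements of finite sets; this
  bound keeps the base used for the weight as small as \<open>D\<close>.\<close>

lemma card_of_finite_subsets_ordLeq:
  assumes "infinite D"
  shows "|{F. finite F \<and> F \<subseteq> D}| \<le>o |D|"
proof -
  have n: "|{F. finite F \<and> F \<subseteq> D \<and> card F = n}| \<le>o |D|" for n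
  proof (induction n)
    case 0
    have "{F. finite F \<and> F \<subseteq> D \<and> card F = 0} = {{}}"
      by auto
    moreover have "D \<noteq> {}"
      using assms by auto
    ultimately show ?case
      using card_of_singl_ordLeq by metis
  next
    case (Suc n)
    let ?E = "{F. finite F \<and> F \<subseteq> D \<and> card F = n}"
    have "{F. finite F \<and> F \<subseteq> D \<and> card F = Suc n} \<subseteq> (\<lambda>(x, F). insert x F) ` (D \<times> ?E)"
    proof safe
      fix F assume F: "finite F" "F \<subseteq> D" "card F = Suc n"
      then obtain x where "x \<in> F"
        by fastforce
      hence "F = insert x (F - {x})" "F - {x} \<in> ?E" "x \<in> D"
        using F by auto
      thus "F \<in> (\<lambda>(x, F). insert x F) ` (D \<times> ?E)"
        by (intro image_eqI[of _ _ "(x, F - {x})"]) auto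
    qed
    hence "|{F. finite F \<and> F \<subseteq> D \<and> card F = Suc n}| \<le>o |D \<times> ?E|"
      by (rule ordLeq_transitive[OF card_of_mono1 card_of_image])
    moreover have "|D \<times> ?E| \<le>o |D|"
      using assms Suc ordLeq_refl[OF card_of_Card_order]
      by (intro card_of_Times_ordLeq_infinite_Field) (simp_all add: Field_card_of card_of_card_order_on)
    ultimately show ?case
      by (rule ordLeq_transitive)
  qed
  have "|\<Union>n\<in>UNIV. {F. finite F \<and> F \<subseteq> D \<and> card F = n}| \<le>o |D|"
    using n assms infinite_iff_card_of_nat by (intro card_of_UNION_ordLeq_infinite) auto
  moreover have "{F. finite F \<and> F \<subseteq> D} = (\<Union>n\<in>UNIV. {F. finite F \<and> F \<subseteq> D \<and> card F = n})"
    by auto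
  ultimately show ?thesis
    by simp
qed

text \<open>Every base contains the singletons of the isolated points, which gives the lower bound. These
  singletons together with the cofinite sets containing \<open>w\<close> are a base of the same size.\<close>

lemma weight_fort_space:
  assumes D: "infinite D" and w: "w \<in> D"
  shows "weight (fort_space D w) =o |D|"
proof -
  obtain h where h: "bij_betw h D (D - {w})"
    using infinite_imp_bij_betw[OF D] by blast
  have lower: "|D| \<le>o |\<B>|" if \<B>: "topology_base (fort_space D w) \<B>" for \<B>
  proof (rule card_of_ordLeqI)
    show "inj_on (\<lambda>x. {h x}) D"
      using h by (auto simp: bij_betw_def inj_on_def)
    show "{h x} \<in> \<B>" if "x \<in> D" for x
    proof -
      have "h x \<in> D - {w}"
        using h that bij_betwE by blast
      hence "openin (fort_space D w) {h x}"
        by (auto simp: openin_fort_space)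
      then obtain B where "B \<in> \<B>" "h x \<in> B" "B \<subseteq> {h x}"
        using \<B> unfolding topology_base_def by blast
      thus ?thesis
        by (metis singletonD subset_singletonD empty_iff)
    qed
  qed
  define \<B> where "\<B> = (\<lambda>x. {x}) ` (D - {w}) \<union> (\<lambda>F. D - F) ` {F. finite F \<and> F \<subseteq> D - {w}}"
  have "topology_base (fort_space D w) \<B>"
    unfolding topology_base_def
  proof (intro conjI ballI allI impI)
    show "openin (fort_space D w) B" if "B \<in> \<B>" for B
      using that by (auto simp: \<B>_def openin_fort_space intro: finite_subset)
    fix U x assume U: "openin (fort_space D w) U" and x: "x \<in> U"
    show "\<exists>B\<in>\<B>. x \<in> B \<and> B \<subseteq> U"
    proof (cases "x = w")
      case True
      hence "finite (D - U)" "D - (D - U) = U" "D - U \<subseteq> D - {w}"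
        using U x by (auto simp: openin_fort_space)
      hence "U \<in> \<B>"
        unfolding \<B>_def by (intro UnI2 image_eqI[of _ _ "D - U"]) auto
      thus ?thesis
        using x by blast
    next
      case False
      thus ?thesis
        using U x by (intro bexI[of _ "{x}"]) (auto simp: \<B>_def openin_fort_space)
    qed
  qed
  moreover have "|\<B>| \<le>o |D|"
    unfolding \<B>_def
  proof (rule card_of_Un_ordLeq_infinite_Field)
    show "infinite (Field |D| )" "Card_order |D|"
      using D by (simp_all add: Field_card_of card_of_card_order_on)
    show "|(\<lambda>x. {x}) ` (D - {w})| \<le>o |D|"
      using card_of_image card_of_mono1[of "D - {w}" D] ordLeq_transitive by blast
    have "|{F. finite F \<and> F \<subseteq> D - {w}}| \<le>o |{F. finite F \<and> F \<subseteq> D}|"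
      by (rule card_of_mono1) auto
    thus "|(\<lambda>F. D - F) ` {F. finite F \<and> F \<subseteq> D - {w}}| \<le>o |D|"
      using card_of_image card_of_finite_subsets_ordLeq[OF D] ordLeq_transitive by blast
  qed
  ultimately have "weight (fort_space D w) \<le>o |D|"
    using is_weight_weight[of "fort_space D w"] ordLeq_transitive unfolding is_weight_def by blast
  moreover have "|D| \<le>o weight (fort_space D w)"
    using is_weight_weight[of "fort_space D w"] lower unfolding is_weight_def by metis
  ultimately show ?thesis
    by (simp add: ordIso_iff_ordLeq)
qed


section \<open>The sum of the spaces of null functions on the fibres of a map\<close>

text \<open>A selector picks at most one element from each of finitely many fibres of \<open>p\<close>. The \<open>l\<^sub>1\<close>-norm
  of the suprema over the fibres is the supremum of the sums over selectors. In this form the norm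
  needs no nested suprema, and the sum of the spaces \<open>c\<^sub>0(p\<^sup>-\<^sup>1(i))\<close> is a space of scalar
  functions on \<open>\<Gamma>\<close>. Finiteness of the norm and membership in \<open>c\<^sub>0\<close> of each fibre already imply
  membership in \<open>c\<^sub>0(\<Gamma>)\<close>.\<close>

definition selectors :: "'g set \<Rightarrow> ('g \<Rightarrow> 'i) \<Rightarrow> 'g set set" where
  "selectors \<Gamma> p = {S. finite S \<and> S \<subseteq> \<Gamma> \<and> inj_on p S}"

definition l1_sum_c0 :: "'g set \<Rightarrow> ('g \<Rightarrow> 'i) \<Rightarrow> ('g \<Rightarrow> real) nspace" where
  "l1_sum_c0 \<Gamma> p =
     \<lparr>vecs = {x \<in> vecs (c0_space \<Gamma>). bdd_above ((\<lambda>S. \<Sum>\<gamma>\<in>S. \<bar>x \<gamma>\<bar>) ` selectors \<Gamma> p)},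
      nrm = (\<lambda>x. Sup (insert 0 ((\<lambda>S. \<Sum>\<gamma>\<in>S. \<bar>x \<gamma>\<bar>) ` selectors \<Gamma> p)))\<rparr>"

lemma l1_sum_c0_in_c0_space: "x \<in> vecs (l1_sum_c0 \<Gamma> p) \<Longrightarrow> x \<in> vecs (c0_space \<Gamma>)"
  by (simp add: l1_sum_c0_def)

lemma in_l1_sum_c0I:
  assumes "x \<in> vecs (c0_space \<Gamma>)" "\<And>S. S \<in> selectors \<Gamma> p \<Longrightarrow> (\<Sum>\<gamma>\<in>S. \<bar>x \<gamma>\<bar>) \<le> B"
  shows "x \<in> vecs (l1_sum_c0 \<Gamma> p)"
  using assms by (auto simp: l1_sum_c0_def intro!: bdd_aboveI2)

lemma sum_selector_le_nrm:
  assumes "x \<in> vecs (l1_sum_c0 \<Gamma> p)" "S \<in> selectors \<Gamma> p"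
  shows "(\<Sum>\<gamma>\<in>S. \<bar>x \<gamma>\<bar>) \<le> nrm (l1_sum_c0 \<Gamma> p) x"
  using assms unfolding l1_sum_c0_def by (auto intro!: cSup_upper)

lemma nrm_l1_sum_c0_le:
  assumes "0 \<le> c" "\<And>S. S \<in> selectors \<Gamma> p \<Longrightarrow> (\<Sum>\<gamma>\<in>S. \<bar>x \<gamma>\<bar>) \<le> c"
  shows "nrm (l1_sum_c0 \<Gamma> p) x \<le> c"
  unfolding l1_sum_c0_def nspace.simps using assms by (intro cSup_least) auto

lemma normed_space_l1_sum_c0: "normed_space (l1_sum_c0 \<Gamma> p)"
proof -
  let ?X = "l1_sum_c0 \<Gamma> p"
  have triangle: "(\<Sum>\<gamma>\<in>S. \<bar>(x + y) \<gamma>\<bar>) \<le> (\<Sum>\<gamma>\<in>S. \<bar>x \<gamma>\<bar>) + (\<Sum>\<gamma>\<in>S. \<bar>y \<gamma>\<bar>)" for x y :: "'a \<Rightarrow> real" and S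
    unfolding sum.distrib[symmetric] by (rule sum_mono) simp
  have scale: "(\<Sum>\<gamma>\<in>S. \<bar>(c *\<^sub>R x) \<gamma>\<bar>) = \<bar>c\<bar> * (\<Sum>\<gamma>\<in>S. \<bar>x \<gamma>\<bar>)" for c and x :: "'a \<Rightarrow> real" and S
    by (simp add: scaleR_fun_def abs_mult sum_distrib_left)
  have "subspace (vecs ?X)"
    unfolding subspace_def
  proof (intro conjI ballI allI)
    show "0 \<in> vecs ?X"
      using subspace_0[OF subspace_c0_space] by (intro in_l1_sum_c0I[where B = 0]) auto
    fix x assume x: "x \<in> vecs ?X"
    show "x + y \<in> vecs ?X" if y: "y \<in> vecs ?X" for y
    proof (rule in_l1_sum_c0I)
      show "x + y \<in> vecs (c0_space \<Gamma>)"
        using subspace_add[OF subspace_c0_space] x y l1_sum_c0_in_c0_space by blast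
      show "(\<Sum>\<gamma>\<in>S. \<bar>(x + y) \<gamma>\<bar>) \<le> nrm ?X x + nrm ?X y" if "S \<in> selectors \<Gamma> p" for S
        using triangle[of x y S] sum_selector_le_nrm[OF x that] sum_selector_le_nrm[OF y that] by linarith
    qed
    show "c *\<^sub>R x \<in> vecs ?X" for c
    proof (rule in_l1_sum_c0I)
      show "c *\<^sub>R x \<in> vecs (c0_space \<Gamma>)"
        using subspace_scale[OF subspace_c0_space] x l1_sum_c0_in_c0_space by blast
      show "(\<Sum>\<gamma>\<in>S. \<bar>(c *\<^sub>R x) \<gamma>\<bar>) \<le> \<bar>c\<bar> * nrm ?X x" if "S \<in> selectors \<Gamma> p" for S
        unfolding scale using sum_selector_le_nrm[OF x that] by (simp add: mult_left_mono)
    qed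
  qed
  hence "normed_space \<lparr>vecs = vecs ?X,
      nrm = (\<lambda>x. Sup (insert 0 ((\<lambda>S. \<Sum>\<gamma>\<in>S. \<bar>x \<gamma>\<bar>) ` selectors \<Gamma> p)))\<rparr>"
  proof (rule normed_space_Sup_seminorms)
    show "x = 0"
      if x: "x \<in> vecs ?X" and le: "\<And>S. S \<in> selectors \<Gamma> p \<Longrightarrow> (\<Sum>\<gamma>\<in>S. \<bar>x \<gamma>\<bar>) \<le> 0" for x
    proof
      fix \<gamma> show "x \<gamma> = 0 \<gamma>"
        using le[of "{\<gamma>}"] l1_sum_c0_in_c0_space[OF x]
        by (cases "\<gamma> \<in> \<Gamma>") (auto simp: selectors_def in_c0_space_iff)
    qed
    show "bdd_above ((\<lambda>S. \<Sum>\<gamma>\<in>S. \<bar>x \<gamma>\<bar>) ` selectors \<Gamma> p)" if "x \<in> vecs ?X" for x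
      using that by (simp add: l1_sum_c0_def)
  qed (rule triangle scale)+
  thus ?thesis
    by (simp add: l1_sum_c0_def)
qed

lemma abs_le_nrm_l1_sum_c0:
  assumes "x \<in> vecs (l1_sum_c0 \<Gamma> p)"
  shows "\<bar>x \<gamma>\<bar> \<le> nrm (l1_sum_c0 \<Gamma> p) x"
proof (cases "\<gamma> \<in> \<Gamma>")
  case True
  thus ?thesis
    using sum_selector_le_nrm[OF assms, of "{\<gamma>}"] by (simp add: selectors_def)
next
  case False
  thus ?thesis
    using l1_sum_c0_in_c0_space[OF assms] nrm_nonneg[OF normed_space_l1_sum_c0 assms]
    by (simp add: in_c0_space_iff)
qed

lemma less_nrm_l1_sum_c0_obtain:
  assumes "0 \<le> c" "c < nrm (l1_sum_c0 \<Gamma> p) x"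
  obtains S where "S \<in> selectors \<Gamma> p" "c < (\<Sum>\<gamma>\<in>S. \<bar>x \<gamma>\<bar>)"
  using nrm_l1_sum_c0_le[OF assms(1), of \<Gamma> p x] assms(2) by force

text \<open>A Cauchy sequence converges coordinatewise. Sums over a fixed selector are finite, so the Cauchy
  estimate passes to the limit uniformly in the selector.\<close>

lemma banach_space_l1_sum_c0: "banach_space (l1_sum_c0 \<Gamma> p)"
proof -
  let ?X = "l1_sum_c0 \<Gamma> p"
  have X: "normed_space ?X"
    by (rule normed_space_l1_sum_c0)
  interpret X: Metric_space "vecs ?X" "ndist ?X"
    by (rule Metric_space_ndist[OF X])
  have "\<exists>x. limitin X.mtopology \<sigma> x sequentially" if "X.MCauchy \<sigma>" for \<sigma>
  proof -
    have \<sigma>X: "\<sigma> n \<in> vecs ?X" for n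
      using that unfolding X.MCauchy_def by blast
    have cauchy: "\<exists>N. \<forall>n\<ge>N. \<forall>m\<ge>N. nrm ?X (\<sigma> n - \<sigma> m) < \<epsilon>" if "\<epsilon> > 0" for \<epsilon>
      using \<open>X.MCauchy \<sigma>\<close> that \<sigma>X unfolding X.MCauchy_def by (fastforce simp: ndist_def)
    have "Cauchy (\<lambda>n. \<sigma> n \<gamma>)" for \<gamma>
    proof (rule CauchyI)
      fix \<epsilon> :: real assume "\<epsilon> > 0"
      from cauchy[OF this] obtain N where "\<forall>n\<ge>N. \<forall>m\<ge>N. nrm ?X (\<sigma> n - \<sigma> m) < \<epsilon>"
        by blast
      moreover have "norm (\<sigma> m \<gamma> - \<sigma> n \<gamma>) \<le> nrm ?X (\<sigma> m - \<sigma> n)" for m n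
        using abs_le_nrm_l1_sum_c0[OF nspace_diff[OF X \<sigma>X \<sigma>X], of m n \<gamma>] by simp
      ultimately show "\<exists>M. \<forall>m\<ge>M. \<forall>n\<ge>M. norm (\<sigma> m \<gamma> - \<sigma> n \<gamma>) < \<epsilon>"
        by (meson order_le_less_trans)
    qed
    hence "\<forall>\<gamma>. \<exists>l. (\<lambda>n. \<sigma> n \<gamma>) \<longlonglongrightarrow> l"
      by (simp add: Cauchy_convergent_iff convergent_def)
    then obtain x where x: "\<And>\<gamma>. (\<lambda>n. \<sigma> n \<gamma>) \<longlonglongrightarrow> x \<gamma>"
      by metis
    have close: "\<exists>N. \<forall>n\<ge>N. \<forall>S\<in>selectors \<Gamma> p. (\<Sum>\<gamma>\<in>S. \<bar>\<sigma> n \<gamma> - x \<gamma>\<bar>) \<le> \<epsilon>" if "\<epsilon> > 0" for \<epsilon>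
    proof -
      from cauchy[OF that] obtain N where N: "\<And>n m. n \<ge> N \<Longrightarrow> m \<ge> N \<Longrightarrow> nrm ?X (\<sigma> n - \<sigma> m) < \<epsilon>"
        by blast
      have "(\<Sum>\<gamma>\<in>S. \<bar>\<sigma> n \<gamma> - x \<gamma>\<bar>) \<le> \<epsilon>" if n: "n \<ge> N" and S: "S \<in> selectors \<Gamma> p" for n S
      proof (rule LIMSEQ_le_const2)
        show "(\<lambda>m. \<Sum>\<gamma>\<in>S. \<bar>\<sigma> n \<gamma> - \<sigma> m \<gamma>\<bar>) \<longlonglongrightarrow> (\<Sum>\<gamma>\<in>S. \<bar>\<sigma> n \<gamma> - x \<gamma>\<bar>)"
          by (intro tendsto_intros x)
        have "(\<Sum>\<gamma>\<in>S. \<bar>\<sigma> n \<gamma> - \<sigma> m \<gamma>\<bar>) \<le> \<epsilon>" if "m \<ge> N" for m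
          using sum_selector_le_nrm[OF nspace_diff[OF X \<sigma>X \<sigma>X] S, of n m] N[OF n that] by simp
        thus "\<exists>N. \<forall>m\<ge>N. (\<Sum>\<gamma>\<in>S. \<bar>\<sigma> n \<gamma> - \<sigma> m \<gamma>\<bar>) \<le> \<epsilon>"
          by blast
      qed
      thus ?thesis
        by blast
    qed
    have off: "x \<gamma> = 0" if "\<gamma> \<notin> \<Gamma>" for \<gamma>
      using x[of \<gamma>] l1_sum_c0_in_c0_space[OF \<sigma>X] that by (simp add: in_c0_space_iff LIMSEQ_const_iff)
    have "finite {\<gamma> \<in> \<Gamma>. \<epsilon> \<le> \<bar>x \<gamma>\<bar>}" if "\<epsilon> > 0" for \<epsilon>
    proof -
      from close[OF half_gt_zero[OF that]] obtain N
        where N: "\<And>S. S \<in> selectors \<Gamma> p \<Longrightarrow> (\<Sum>\<gamma>\<in>S. \<bar>\<sigma> N \<gamma> - x \<gamma>\<bar>) \<le> \<epsilon> / 2"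
        by blast
      have "finite {\<gamma> \<in> \<Gamma>. \<epsilon> / 2 \<le> \<bar>\<sigma> N \<gamma>\<bar>}"
        using l1_sum_c0_in_c0_space[OF \<sigma>X] half_gt_zero[OF that] unfolding in_c0_space_iff by blast
      moreover have "\<epsilon> / 2 \<le> \<bar>\<sigma> N \<gamma>\<bar>" if "\<gamma> \<in> \<Gamma>" "\<epsilon> \<le> \<bar>x \<gamma>\<bar>" for \<gamma>
        using N[of "{\<gamma>}"] that abs_triangle_ineq2_sym[of "x \<gamma>" "\<sigma> N \<gamma>"]
        by (simp add: selectors_def)
      hence "{\<gamma> \<in> \<Gamma>. \<epsilon> \<le> \<bar>x \<gamma>\<bar>} \<subseteq> {\<gamma> \<in> \<Gamma>. \<epsilon> / 2 \<le> \<bar>\<sigma> N \<gamma>\<bar>}"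
        by blast
      ultimately show ?thesis
        by (rule finite_subset[rotated])
    qed
    hence xc0: "x \<in> vecs (c0_space \<Gamma>)"
      using off by (simp add: in_c0_space_iff)
    have "x \<in> vecs ?X"
    proof -
      from close[OF zero_less_one] obtain N
        where N: "\<And>S. S \<in> selectors \<Gamma> p \<Longrightarrow> (\<Sum>\<gamma>\<in>S. \<bar>\<sigma> N \<gamma> - x \<gamma>\<bar>) \<le> 1"
        by blast
      show ?thesis
      proof (rule in_l1_sum_c0I[OF xc0])
        fix S assume S: "S \<in> selectors \<Gamma> p"
        have "(\<Sum>\<gamma>\<in>S. \<bar>x \<gamma>\<bar>) \<le> (\<Sum>\<gamma>\<in>S. \<bar>\<sigma> N \<gamma>\<bar> + \<bar>\<sigma> N \<gamma> - x \<gamma>\<bar>)"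
          by (rule sum_mono) arith
        also have "\<dots> \<le> nrm ?X (\<sigma> N) + 1"
          unfolding sum.distrib using N[OF S] sum_selector_le_nrm[OF \<sigma>X S, of N] by simp
        finally show "(\<Sum>\<gamma>\<in>S. \<bar>x \<gamma>\<bar>) \<le> nrm ?X (\<sigma> N) + 1" .
      qed
    qed
    moreover have "\<exists>N. \<forall>n\<ge>N. \<sigma> n \<in> vecs ?X \<and> ndist ?X (\<sigma> n) x < \<epsilon>" if "\<epsilon> > 0" for \<epsilon>
    proof -
      from close[OF half_gt_zero[OF that]] obtain N
        where N: "\<And>n S. n \<ge> N \<Longrightarrow> S \<in> selectors \<Gamma> p \<Longrightarrow> (\<Sum>\<gamma>\<in>S. \<bar>\<sigma> n \<gamma> - x \<gamma>\<bar>) \<le> \<epsilon> / 2"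
        by blast
      have "nrm ?X (\<sigma> n - x) \<le> \<epsilon> / 2" if "n \<ge> N" for n
        using N[OF that] \<open>\<epsilon> > 0\<close> by (intro nrm_l1_sum_c0_le) auto
      hence "nrm ?X (\<sigma> n - x) < \<epsilon>" if "n \<ge> N" for n
        using that \<open>\<epsilon> > 0\<close> by fastforce
      thus ?thesis
        using \<sigma>X \<open>x \<in> vecs ?X\<close> by (auto simp: ndist_def)
    qed
    ultimately have "limitin X.mtopology \<sigma> x sequentially"
      unfolding X.limit_metric_sequentially by blast
    thus ?thesis
      by blast
  qed
  thus ?thesis
    using X unfolding banach_space_def X.mcomplete_def by blast
qed


section \<open>A complemented copy inside the continuous functions\<close>

lemma sum_selector_fibre_le:
  fixes a :: "'g \<Rightarrow> real"
  assumes "S \<in> selectors \<Gamma> p" "0 \<le> c" "\<And>\<gamma>. p \<gamma> = i \<Longrightarrow> \<bar>a \<gamma>\<bar> \<le> c"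
  shows "(\<Sum>\<gamma>\<in>S. \<bar>if p \<gamma> = i then a \<gamma> else 0\<bar>) \<le> c"
proof -
  have S: "finite S" "inj_on p S"
    using assms(1) by (simp_all add: selectors_def)
  have "(\<Sum>\<gamma>\<in>S. \<bar>if p \<gamma> = i then a \<gamma> else 0\<bar>) = (\<Sum>\<gamma>\<in>{\<gamma>\<in>S. p \<gamma> = i}. \<bar>a \<gamma>\<bar>)"
    using S(1) by (subst sum.inter_filter) (auto intro: sum.cong)
  also have "\<dots> \<le> c"
  proof (cases "{\<gamma>\<in>S. p \<gamma> = i} = {}")
    case True
    thus ?thesis
      using assms(2) by (simp only: sum.empty)
  next
    case False
    then obtain \<gamma> where "{\<gamma>\<in>S. p \<gamma> = i} = {\<gamma>}" "p \<gamma> = i"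
      using S(2) by (auto simp: inj_on_def)
    thus ?thesis
      using assms(3) by simp
  qed
  finally show ?thesis .
qed

text \<open>\<open>J\<close> distributes a null function \<open>a\<close> over the fibres. It is continuous at \<open>w\<close> because only
  finitely many fibres carry a large value of \<open>a\<close>. For a continuous \<open>f\<close> the value \<open>f w\<close> has to be
  subtracted in \<open>Q f\<close>: the diagonal \<open>\<gamma> \<mapsto> f (p \<gamma>) \<gamma>\<close> alone tends to zero only modulo \<open>f w\<close>, while
  after the subtraction continuity at \<open>w\<close> leaves finitely many fibres with large values.\<close>

lemma C_space_fort_space_contains_complemented_c0:
  fixes p :: "'g \<Rightarrow> 'k"
  assumes w: "w \<in> D" and p: "p ` \<Gamma> \<subseteq> D - {w}"
  shows "contains_complemented_copy (C_space (fort_space D w) (l1_sum_c0 \<Gamma> p)) (c0_space \<Gamma>)"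
proof -
  let ?Z = "c0_space \<Gamma>" and ?X = "l1_sum_c0 \<Gamma> p" and ?K = "fort_space D w"
  let ?Y = "C_space ?K ?X"
  note X = normed_space_l1_sum_c0[of \<Gamma> p]
  note Z = normed_space_c0_space[of \<Gamma>]
  have K: "compact_space ?K"
    using w by (rule compact_space_fort_space)
  have Y: "normed_space ?Y"
    using X K by (rule normed_space_C_space)
  define J :: "('g \<Rightarrow> real) \<Rightarrow> 'k \<Rightarrow> 'g \<Rightarrow> real" where "J a i = (\<lambda>\<gamma>. if p \<gamma> = i then a \<gamma> else 0)" for a i
  define Q :: "('k \<Rightarrow> 'g \<Rightarrow> real) \<Rightarrow> 'g \<Rightarrow> real" where "Q f = (\<lambda>\<gamma>. f (p \<gamma>) \<gamma> - f w \<gamma>)" for f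
  have zero_off: "a \<gamma> = 0" if "a \<in> vecs ?Z" "p \<gamma> \<notin> D - {w}" for a \<gamma>
    using that p unfolding in_c0_space_iff by blast
  have J_le: "nrm ?X (J a i) \<le> c" if "0 \<le> c" "\<And>\<gamma>. p \<gamma> = i \<Longrightarrow> \<bar>a \<gamma>\<bar> \<le> c" for a i c
    unfolding J_def using that by (intro nrm_l1_sum_c0_le sum_selector_fibre_le)
  have JX: "J a i \<in> vecs ?X" if a: "a \<in> vecs ?Z" for a i
  proof (rule in_l1_sum_c0I)
    show "J a i \<in> vecs ?Z"
      using a by (rule c0_space_dominated) (simp add: J_def)
    show "(\<Sum>\<gamma>\<in>S. \<bar>J a i \<gamma>\<bar>) \<le> nrm ?Z a" if "S \<in> selectors \<Gamma> p" for S
      unfolding J_def using that nrm_nonneg[OF Z a] abs_le_nrm_c0[OF a] by (rule sum_selector_fibre_le)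
  qed
  have J_off: "J a i = 0" if "a \<in> vecs ?Z" "i \<notin> D - {w}" for a i
    using zero_off[OF that(1)] that(2) by (auto simp: J_def fun_eq_iff)
  have JY: "J a \<in> vecs ?Y" if a: "a \<in> vecs ?Z" for a
    unfolding in_C_space_iff[OF X] topspace_fort_space
  proof (intro conjI allI impI ballI)
    show "J a x = 0" if "x \<notin> D" for x
      using J_off[OF a] that by blast
    show "range (J a) \<subseteq> vecs ?X"
      using JX[OF a] by blast
    fix x and \<epsilon> :: real assume x: "x \<in> D" and \<epsilon>: "\<epsilon> > 0"
    show "\<exists>U. openin ?K U \<and> x \<in> U \<and> (\<forall>y\<in>U. nrm ?X (J a y - J a x) < \<epsilon>)"
    proof (cases "x = w")
      case False
      thus ?thesis
        using x \<epsilon> nrm_zero[OF X] by (intro exI[of _ "{x}"]) (simp add: openin_fort_space)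
    next
      case True
      let ?G = "{\<gamma>\<in>\<Gamma>. \<epsilon> / 2 \<le> \<bar>a \<gamma>\<bar>}"
      have "finite ?G"
        using a half_gt_zero[OF \<epsilon>] unfolding in_c0_space_iff by blast
      hence "openin ?K (D - p ` ?G)"
        by (auto simp: openin_fort_space Diff_Diff_Int)
      moreover have "x \<in> D - p ` ?G"
        using True w p by auto
      moreover have "nrm ?X (J a y - J a x) < \<epsilon>" if y: "y \<in> D - p ` ?G" for y
      proof -
        have "\<bar>a \<gamma>\<bar> \<le> \<epsilon> / 2" if "p \<gamma> = y" for \<gamma>
        proof (cases "\<gamma> \<in> \<Gamma>")
          case True
          thus ?thesis
            using y that by force
        next
          case False
          thus ?thesis
            using a \<epsilon> by (simp add: in_c0_space_iff)
        qed
        hence "nrm ?X (J a y) \<le> \<epsilon> / 2"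
          using \<epsilon> by (intro J_le) auto
        moreover have "J a x = 0"
          using True by (intro J_off[OF a]) simp
        ultimately show ?thesis
          using \<epsilon> by simp
      qed
      ultimately show ?thesis
        by blast
    qed
  qed
  have J: "bounded_linear_between ?Z ?Y J"
    unfolding bounded_linear_between_def linear_map_between_def
  proof (intro conjI ballI allI exI[of _ 1])
    show "J ` vecs ?Z \<subseteq> vecs ?Y"
      using JY by blast
    show "J (x + y) = J x + J y" for x y
      by (auto simp: J_def fun_eq_iff)
    show "J (c *\<^sub>R x) = c *\<^sub>R J x" for c x
      by (auto simp: J_def fun_eq_iff scaleR_fun_def)
    show "nrm ?Y (J x) \<le> 1 * nrm ?Z x" if "x \<in> vecs ?Z" for x
      using nrm_nonneg[OF Z that] abs_le_nrm_c0[OF that] by (auto intro!: nrm_C_space_le J_le)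
  qed
  have fX: "f i \<in> vecs ?X" if "f \<in> vecs ?Y" for f i
    using that unfolding in_C_space_iff[OF X] by blast
  have QZ: "Q f \<in> vecs ?Z" if f: "f \<in> vecs ?Y" for f
    unfolding in_c0_space_iff
  proof (intro conjI allI impI)
    show "Q f \<gamma> = 0" if "\<gamma> \<notin> \<Gamma>" for \<gamma>
      using l1_sum_c0_in_c0_space[OF fX[OF f]] that by (simp add: Q_def in_c0_space_iff)
    fix \<epsilon> :: real assume \<epsilon>: "\<epsilon> > 0"
    then obtain U where U: "openin ?K U" "w \<in> U" and close: "\<And>i. i \<in> U \<Longrightarrow> nrm ?X (f i - f w) < \<epsilon>"
      using f w unfolding in_C_space_iff[OF X] topspace_fort_space by meson
    have diffX: "f i - f w \<in> vecs ?X" for i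
      using fX[OF f] by (intro nspace_diff[OF X])
    have "{\<gamma> \<in> \<Gamma>. \<epsilon> \<le> \<bar>Q f \<gamma>\<bar>} \<subseteq> (\<Union>i\<in>D - U. {\<gamma> \<in> \<Gamma>. \<epsilon> \<le> \<bar>(f i - f w) \<gamma>\<bar>})"
    proof
      fix \<gamma> assume "\<gamma> \<in> {\<gamma> \<in> \<Gamma>. \<epsilon> \<le> \<bar>Q f \<gamma>\<bar>}"
      hence \<gamma>: "\<gamma> \<in> \<Gamma>" "\<epsilon> \<le> \<bar>(f (p \<gamma>) - f w) \<gamma>\<bar>"
        by (auto simp: Q_def)
      moreover have "p \<gamma> \<in> D - U"
        using \<gamma> close[of "p \<gamma>"] abs_le_nrm_l1_sum_c0[OF diffX, of "p \<gamma>" \<gamma>] p by fastforce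
      ultimately show "\<gamma> \<in> (\<Union>i\<in>D - U. {\<gamma> \<in> \<Gamma>. \<epsilon> \<le> \<bar>(f i - f w) \<gamma>\<bar>})"
        by blast
    qed
    moreover have "finite (D - U)"
      using U by (simp add: openin_fort_space)
    moreover have "finite {\<gamma> \<in> \<Gamma>. \<epsilon> \<le> \<bar>(f i - f w) \<gamma>\<bar>}" for i
      using l1_sum_c0_in_c0_space[OF diffX] \<epsilon> unfolding in_c0_space_iff by blast
    ultimately show "finite {\<gamma> \<in> \<Gamma>. \<epsilon> \<le> \<bar>Q f \<gamma>\<bar>}"
      by (meson finite_UN_I finite_subset)
  qed
  have Q: "bounded_linear_between ?Y ?Z Q"
    unfolding bounded_linear_between_def linear_map_between_def
  proof (intro conjI ballI allI exI[of _ 2])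
    show "Q ` vecs ?Y \<subseteq> vecs ?Z"
      using QZ by blast
    show "Q (x + y) = Q x + Q y" for x y
      by (auto simp: Q_def fun_eq_iff)
    show "Q (c *\<^sub>R x) = c *\<^sub>R Q x" for c x
      by (auto simp: Q_def fun_eq_iff scaleR_fun_def algebra_simps)
    show "nrm ?Z (Q f) \<le> 2 * nrm ?Y f" if f: "f \<in> vecs ?Y" for f
    proof (rule nrm_c0_le)
      show "0 \<le> 2 * nrm ?Y f"
        using nrm_nonneg[OF Y f] by simp
      have "\<bar>f i \<gamma>\<bar> \<le> nrm ?Y f" if "i \<in> D" for i \<gamma>
        using abs_le_nrm_l1_sum_c0[OF fX[OF f], of i \<gamma>] nrm_le_nrm_C_space[OF X K f, of i] that
        by (simp add: topspace_fort_space)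
      moreover have "\<bar>Q f \<gamma>\<bar> \<le> \<bar>f (p \<gamma>) \<gamma>\<bar> + \<bar>f w \<gamma>\<bar>" for \<gamma>
        unfolding Q_def by (rule abs_triangle_ineq4)
      moreover have "p \<gamma> \<in> D" if "\<gamma> \<in> \<Gamma>" for \<gamma>
        using p that by blast
      ultimately show "\<bar>Q f \<gamma>\<bar> \<le> 2 * nrm ?Y f" if "\<gamma> \<in> \<Gamma>" for \<gamma>
        using w that by (smt (verit))
    qed
  qed
  have "Q (J a) = a" if "a \<in> vecs ?Z" for a
    using J_off[OF that, of w] by (auto simp: Q_def J_def fun_eq_iff)
  thus ?thesis
    by (rule contains_complemented_copyI[OF Y Z J Q])
qed


section \<open>Embeddings of spaces of null functions into the sum\<close>

text \<open>This set stays in the unit ball of \<open>c\<^sub>0\<close> when a signed unit vector with a new index is added,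
  which is the only feature of \<open>c\<^sub>0\<close> that the next arguments exploit.\<close>

definition finite_unit_ball :: "'g set \<Rightarrow> ('g \<Rightarrow> real) set" where
  "finite_unit_ball A = {f. finite {\<gamma>. f \<gamma> \<noteq> 0} \<and> {\<gamma>. f \<gamma> \<noteq> 0} \<subseteq> A \<and> (\<forall>\<gamma>. \<bar>f \<gamma>\<bar> \<le> 1)}"

lemma finite_unit_ball_in_c0:
  assumes "f \<in> finite_unit_ball A" "A \<subseteq> \<Gamma>"
  shows "f \<in> vecs (c0_space \<Gamma>)" "nrm (c0_space \<Gamma>) f \<le> 1"
  using assms by (auto simp: finite_unit_ball_def intro!: finite_support_in_c0_space nrm_c0_le)

lemma finite_unit_ball_insert:
  assumes "f \<in> finite_unit_ball A" "f \<gamma> = 0" "\<bar>c\<bar> \<le> 1"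
  shows "f + c *\<^sub>R indicator {\<gamma>} \<in> finite_unit_ball (insert \<gamma> A)"
proof -
  have "{x. (f + c *\<^sub>R indicator {\<gamma>}) x \<noteq> 0} \<subseteq> insert \<gamma> {x. f x \<noteq> 0}"
    by (auto simp: scaleR_fun_def indicator_def split: if_splits)
  moreover have "\<bar>(f + c *\<^sub>R indicator {\<gamma>}) x\<bar> \<le> 1" for x
    using assms by (cases "x = \<gamma>") (auto simp: finite_unit_ball_def scaleR_fun_def)
  ultimately show ?thesis
    using assms(1) by (auto simp: finite_unit_ball_def intro: finite_subset)
qed

lemma indicator_in_c0_space:
  assumes "\<gamma> \<in> \<Gamma>"
  shows "indicator {\<gamma>} \<in> vecs (c0_space \<Gamma>)"
  using assms by (intro finite_support_in_c0_space) (auto simp: indicator_def)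

context
  fixes \<Gamma> :: "'g set" and Y :: "('h \<Rightarrow> real) nspace" and T
  assumes T: "linear_map_between (c0_space \<Gamma>) Y T"
begin

lemma image_add_signed_indicator:
  assumes "f \<in> vecs (c0_space \<Gamma>)" "\<gamma> \<in> \<Gamma>"
  shows "T (f + c *\<^sub>R indicator {\<gamma>}) s = T f s + c * T (indicator {\<gamma>}) s"
  using T assms indicator_in_c0_space[OF assms(2)]
    nspace_scale[OF normed_space_c0_space indicator_in_c0_space[OF assms(2)]]
  unfolding linear_map_between_def by (simp add: scaleR_fun_def)

text \<open>The functional \<open>f \<mapsto> T f s\<close> is represented by an \<open>l\<^sub>1\<close>-sequence: with suitable signs, the
  absolute values of its coefficients add up on a vector of norm at most one.\<close>

lemma finite_large_coordinates:
  assumes bound: "\<And>f. f \<in> vecs (c0_space \<Gamma>) \<Longrightarrow> nrm (c0_space \<Gamma>) f \<le> 1 \<Longrightarrow> \<bar>T f s\<bar> \<le> C"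
    and c: "c > 0"
  shows "finite {\<gamma> \<in> \<Gamma>. c \<le> \<bar>T (indicator {\<gamma>}) s\<bar>}"
proof (rule ccontr)
  have signs: "\<exists>f\<in>finite_unit_ball A. (\<Sum>\<gamma>\<in>A. \<bar>T (indicator {\<gamma>}) s\<bar>) \<le> \<bar>T f s\<bar>"
    if "finite A" "A \<subseteq> \<Gamma>" for A
    using that
  proof (induction A)
    case empty
    show ?case
      by (intro bexI[of _ 0]) (auto simp: finite_unit_ball_def)
  next
    case (insert \<gamma> A)
    then obtain f where f: "f \<in> finite_unit_ball A"
      and le: "(\<Sum>\<gamma>\<in>A. \<bar>T (indicator {\<gamma>}) s\<bar>) \<le> \<bar>T f s\<bar>"
      by blast
    have fZ: "f \<in> vecs (c0_space \<Gamma>)"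
      using finite_unit_ball_in_c0(1)[OF f] insert.prems by blast
    have "f \<gamma> = 0"
      using f insert.hyps by (auto simp: finite_unit_ball_def)
    note new = finite_unit_ball_insert[OF f this]
    let ?t = "T (indicator {\<gamma>}) s"
    \<comment> \<open>The sign of the new unit vector is chosen so that nothing cancels.\<close>
    have "\<bar>T f s + ?t\<bar> = \<bar>T f s\<bar> + \<bar>?t\<bar> \<or> \<bar>T f s - ?t\<bar> = \<bar>T f s\<bar> + \<bar>?t\<bar>"
      by arith
    then obtain c where c: "\<bar>c\<bar> \<le> 1" "\<bar>T f s + c * ?t\<bar> = \<bar>T f s\<bar> + \<bar>?t\<bar>"
      by (metis abs_minus_cancel abs_one diff_conv_add_uminus mult_1 mult_minus1 order_refl)
    have "T (f + c *\<^sub>R indicator {\<gamma>}) s = T f s + c * ?t"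
      using insert.prems by (intro image_add_signed_indicator[OF fZ]) blast
    hence "(\<Sum>\<gamma>\<in>insert \<gamma> A. \<bar>T (indicator {\<gamma>}) s\<bar>) \<le> \<bar>T (f + c *\<^sub>R indicator {\<gamma>}) s\<bar>"
      unfolding sum.insert[OF insert.hyps] using le c(2) by simp
    thus ?case
      using new[OF c(1)] by blast
  qed
  assume "infinite {\<gamma> \<in> \<Gamma>. c \<le> \<bar>T (indicator {\<gamma>}) s\<bar>}"
  moreover obtain n :: nat where n: "C < n * c"
    using c ex_less_of_nat_mult by blast
  ultimately obtain A where A: "A \<subseteq> {\<gamma> \<in> \<Gamma>. c \<le> \<bar>T (indicator {\<gamma>}) s\<bar>}" "finite A" "card A = n"
    using infinite_arbitrarily_large by blast
  then obtain f where f: "f \<in> finite_unit_ball A"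
    and le: "(\<Sum>\<gamma>\<in>A. \<bar>T (indicator {\<gamma>}) s\<bar>) \<le> \<bar>T f s\<bar>"
    using signs[of A] by blast
  have "n * c \<le> (\<Sum>\<gamma>\<in>A. \<bar>T (indicator {\<gamma>}) s\<bar>)"
    using A by (intro order_trans[OF _ sum_bounded_below]) auto
  also have "\<dots> \<le> C"
    using le bound[OF finite_unit_ball_in_c0[OF f]] A(1) by fastforce
  finally show False
    using n by simp
qed

text \<open>A gliding hump argument. If it failed, one could choose successively new unit vectors and
  selectors over new summands on which their images have mass at least \<open>\<epsilon>\<close>. Averaging over the two
  signs of the new vector shows that for one of them the mass over all selectors chosen so far
  grows by \<open>\<epsilon>\<close>, whatever the new image does on the old selectors and vice versa. Thus a vector
  of norm at most one has an image of arbitrarily large norm.\<close>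

lemma uniformly_small_tails:
  fixes p :: "'h \<Rightarrow> 'i"
  assumes bound: "\<And>f S. f \<in> vecs (c0_space \<Gamma>) \<Longrightarrow> nrm (c0_space \<Gamma>) f \<le> 1 \<Longrightarrow>
      S \<in> selectors \<Delta> p \<Longrightarrow> (\<Sum>s\<in>S. \<bar>T f s\<bar>) \<le> C"
    and \<epsilon>: "\<epsilon> > 0"
  shows "\<exists>F E. finite F \<and> finite E \<and> (\<forall>\<gamma>\<in>\<Gamma> - E. \<forall>S\<in>selectors \<Delta> p. p ` S \<inter> F = {} \<longrightarrow>
       (\<Sum>s\<in>S. \<bar>T (indicator {\<gamma>}) s\<bar>) < \<epsilon>)"
    (is "\<exists>F E. finite F \<and> finite E \<and> ?small F E")
proof (rule ccontr)
  assume "\<not> (\<exists>F E. finite F \<and> finite E \<and> ?small F E)"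
  have ex: "\<exists>\<gamma> S. \<gamma> \<in> \<Gamma> - E \<and> S \<in> selectors \<Delta> p \<and> p ` S \<inter> F = {} \<and>
      \<epsilon> \<le> (\<Sum>s\<in>S. \<bar>T (indicator {\<gamma>}) s\<bar>)" if "finite F" "finite E" for F E
  proof -
    have "\<not> ?small F E"
      using \<open>\<not> (\<exists>F E. finite F \<and> finite E \<and> ?small F E)\<close> that by blast
    thus ?thesis
      by (metis not_less)
  qed
  have "\<exists>f\<in>finite_unit_ball \<Gamma>. \<exists>S\<in>selectors \<Delta> p. n * \<epsilon> \<le> (\<Sum>s\<in>S. \<bar>T f s\<bar>)" for n :: nat
  proof (induction n)
    case 0
    show ?case
      by (intro bexI[of _ 0] bexI[of _ "{}"]) (auto simp: finite_unit_ball_def selectors_def)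
  next
    case (Suc n)
    then obtain f S where f: "f \<in> finite_unit_ball \<Gamma>" and S: "S \<in> selectors \<Delta> p"
      and le: "n * \<epsilon> \<le> (\<Sum>s\<in>S. \<bar>T f s\<bar>)"
      by blast
    have "finite (p ` S)" "finite {\<gamma>. f \<gamma> \<noteq> 0}"
      using f S by (auto simp: selectors_def finite_unit_ball_def)
    from ex[OF this] obtain \<gamma> R where \<gamma>: "\<gamma> \<in> \<Gamma>" "f \<gamma> = 0" and R: "R \<in> selectors \<Delta> p"
      and disj: "p ` R \<inter> p ` S = {}" and large: "\<epsilon> \<le> (\<Sum>s\<in>R. \<bar>T (indicator {\<gamma>}) s\<bar>)"
      by blast
    let ?t = "T (indicator {\<gamma>})"
    have fZ: "f \<in> vecs (c0_space \<Gamma>)"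
      using finite_unit_ball_in_c0(1)[OF f] by blast
    have new: "f + c *\<^sub>R indicator {\<gamma>} \<in> finite_unit_ball \<Gamma>" if "\<bar>c\<bar> \<le> 1" for c
      using finite_unit_ball_insert[of f \<Gamma> \<gamma> c] f \<gamma> that by (simp add: insert_absorb)
    have SR: "S \<union> R \<in> selectors \<Delta> p"
      using S R disj by (auto simp: selectors_def inj_on_Un)
    have "S \<inter> R = {}"
      using disj by blast
    hence split: "sum h (S \<union> R) = sum h S + sum h R" for h :: "'h \<Rightarrow> real"
      using S R by (intro sum.union_disjoint) (auto simp: selectors_def)
    \<comment> \<open>Pointwise \<open>\<bar>a + b\<bar> + \<bar>a - b\<bar>\<close> is at least \<open>2 * \<bar>a\<bar>\<close>, used on \<open>S\<close>, and at least
      \<open>2 * \<bar>b\<bar>\<close>, used on \<open>R\<close>.\<close>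
    have "2 * ((\<Sum>s\<in>S. \<bar>T f s\<bar>) + (\<Sum>s\<in>R. \<bar>?t s\<bar>))
        = (\<Sum>s\<in>S. 2 * \<bar>T f s\<bar>) + (\<Sum>s\<in>R. 2 * \<bar>?t s\<bar>)"
      by (simp add: sum_distrib_left)
    also have "\<dots> \<le> (\<Sum>s\<in>S \<union> R. \<bar>T f s + ?t s\<bar> + \<bar>T f s - ?t s\<bar>)"
      unfolding split by (intro add_mono sum_mono) arith+
    also have "\<dots> = (\<Sum>s\<in>S \<union> R. \<bar>T f s + ?t s\<bar>) + (\<Sum>s\<in>S \<union> R. \<bar>T f s - ?t s\<bar>)"
      by (rule sum.distrib)
    finally have "Suc n * \<epsilon> \<le> (\<Sum>s\<in>S \<union> R. \<bar>T f s + ?t s\<bar>) \<or> Suc n * \<epsilon> \<le> (\<Sum>s\<in>S \<union> R. \<bar>T f s - ?t s\<bar>)"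
      using le large by (auto simp: algebra_simps)
    then obtain c where c: "\<bar>c\<bar> \<le> 1" "Suc n * \<epsilon> \<le> (\<Sum>s\<in>S \<union> R. \<bar>T f s + c * ?t s\<bar>)"
    proof
      assume "Suc n * \<epsilon> \<le> (\<Sum>s\<in>S \<union> R. \<bar>T f s + ?t s\<bar>)"
      thus thesis
        using that[of 1] by simp
    next
      assume "Suc n * \<epsilon> \<le> (\<Sum>s\<in>S \<union> R. \<bar>T f s - ?t s\<bar>)"
      thus thesis
        using that[of "-1"] by simp
    qed
    hence "Suc n * \<epsilon> \<le> (\<Sum>s\<in>S \<union> R. \<bar>T (f + c *\<^sub>R indicator {\<gamma>}) s\<bar>)"
      unfolding image_add_signed_indicator[OF fZ \<gamma>(1)] by blast
    thus ?case
      using new[OF c(1)] SR by blast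
  qed
  moreover obtain n :: nat where "C < n * \<epsilon>"
    using \<epsilon> ex_less_of_nat_mult by blast
  ultimately show False
    using bound finite_unit_ball_in_c0[OF _ subset_refl] by (meson not_le order_trans)
qed

end

text \<open>An embedded unit vector that is not exceptional has mass less than \<open>\<delta> / 2\<close> outside the summands
  in \<open>F\<close>. A selector nearly realising its norm therefore keeps mass \<open>\<delta> / 4\<close> on at most \<open>card F\<close>
  coordinates, one of which is not small.\<close>

lemma embedding_c0_into_l1_sum_c0:
  fixes p :: "'h \<Rightarrow> 'i"
  assumes T: "bounded_linear_between (c0_space \<Gamma>) (l1_sum_c0 \<Delta> p) T" and "\<delta> > 0"
    and below: "\<And>f. f \<in> vecs (c0_space \<Gamma>) \<Longrightarrow> \<delta> * nrm (c0_space \<Gamma>) f \<le> nrm (l1_sum_c0 \<Delta> p) (T f)"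
  obtains F E G where "finite F" "finite E" "\<And>s. finite (G s)"
    "\<Gamma> \<subseteq> E \<union> (\<Union>s\<in>{s\<in>\<Delta>. p s \<in> F}. G s)"
proof -
  let ?X = "l1_sum_c0 \<Delta> p" and ?Z = "c0_space \<Gamma>"
  have lin: "linear_map_between ?Z ?X T"
    using T by (simp add: bounded_linear_between_def)
  obtain C where C: "C > 0" "\<And>f. f \<in> vecs ?Z \<Longrightarrow> nrm ?X (T f) \<le> C * nrm ?Z f"
    using bounded_linear_between_obtain[OF normed_space_c0_space T] by blast
  have TX: "T f \<in> vecs ?X" if "f \<in> vecs ?Z" for f
    using lin that unfolding linear_map_between_def by blast
  have bound: "nrm ?X (T f) \<le> C" if "f \<in> vecs ?Z" "nrm ?Z f \<le> 1" for f
    using C(2)[OF that(1)] mult_left_mono[OF that(2), of C] C(1) by linarith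
  have "\<exists>F E. finite F \<and> finite E \<and> (\<forall>\<gamma>\<in>\<Gamma> - E. \<forall>S\<in>selectors \<Delta> p. p ` S \<inter> F = {} \<longrightarrow>
      (\<Sum>s\<in>S. \<bar>T (indicator {\<gamma>}) s\<bar>) < \<delta> / 2)"
  proof (rule uniformly_small_tails[OF lin])
    show "(\<Sum>s\<in>S. \<bar>T f s\<bar>) \<le> C"
      if "f \<in> vecs ?Z" "nrm ?Z f \<le> 1" "S \<in> selectors \<Delta> p" for f S
      using sum_selector_le_nrm[OF TX[OF that(1)] that(3)] bound[OF that(1,2)] by simp
  qed (use \<open>\<delta> > 0\<close> in simp)
  then obtain F E where F: "finite F" and E: "finite E"
    and tail: "\<forall>\<gamma>\<in>\<Gamma> - E. \<forall>S\<in>selectors \<Delta> p. p ` S \<inter> F = {} \<longrightarrow>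
      (\<Sum>s\<in>S. \<bar>T (indicator {\<gamma>}) s\<bar>) < \<delta> / 2"
    by blast
  \<comment> \<open>Adding 1 keeps the denominator positive when \<open>F\<close> is empty.\<close>
  define c where "c = \<delta> / (4 * (card F + 1))"
  have c: "c > 0"
    using \<open>\<delta> > 0\<close> by (simp add: c_def)
  define G where "G s = {\<gamma> \<in> \<Gamma>. c \<le> \<bar>T (indicator {\<gamma>}) s\<bar>}" for s
  have "finite (G s)" for s
    unfolding G_def
  proof (rule finite_large_coordinates[OF lin _ c])
    show "\<bar>T f s\<bar> \<le> C" if "f \<in> vecs ?Z" "nrm ?Z f \<le> 1" for f
      using abs_le_nrm_l1_sum_c0[OF TX[OF that(1)], of s] bound[OF that] by simp
  qed
  moreover have "\<Gamma> \<subseteq> E \<union> (\<Union>s\<in>{s\<in>\<Delta>. p s \<in> F}. G s)"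
  proof
    fix \<gamma> assume \<gamma>: "\<gamma> \<in> \<Gamma>"
    let ?t = "T (indicator {\<gamma>})"
    show "\<gamma> \<in> E \<union> (\<Union>s\<in>{s\<in>\<Delta>. p s \<in> F}. G s)"
    proof (cases "\<gamma> \<in> E")
      case False
      have "1 \<le> nrm ?Z (indicator {\<gamma>})"
        using abs_le_nrm_c0[OF indicator_in_c0_space[OF \<gamma>], of \<gamma>] by simp
      hence "\<delta> \<le> nrm ?X ?t"
        using below[OF indicator_in_c0_space[OF \<gamma>]] \<open>\<delta> > 0\<close>
        by (smt (verit) mult_le_cancel_left1)
      then obtain S where S: "S \<in> selectors \<Delta> p" and large: "3 / 4 * \<delta> < (\<Sum>s\<in>S. \<bar>?t s\<bar>)"
        using less_nrm_l1_sum_c0_obtain[of "3 / 4 * \<delta>" \<Delta> p ?t] \<open>\<delta> > 0\<close> by auto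
      let ?A = "{s\<in>S. p s \<in> F}" and ?B = "{s\<in>S. p s \<notin> F}"
      have "(\<Sum>s\<in>?B. \<bar>?t s\<bar>) < \<delta> / 2"
        using S \<gamma> False
        by (intro tail[rule_format]) (auto simp: selectors_def intro: inj_on_subset)
      moreover have "(\<Sum>s\<in>S. \<bar>?t s\<bar>) = (\<Sum>s\<in>?A. \<bar>?t s\<bar>) + (\<Sum>s\<in>?B. \<bar>?t s\<bar>)"
        using S by (subst sum.union_disjoint[symmetric]) (auto simp: selectors_def intro: sum.cong)
      ultimately have A: "\<delta> / 4 < (\<Sum>s\<in>?A. \<bar>?t s\<bar>)"
        using large by simp
      have "card ?A \<le> card F"
        using S F by (intro card_inj_on_le[of p]) (auto simp: selectors_def intro: inj_on_subset)
      hence "card ?A * c \<le> (card F + 1) * c"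
        using c by (intro mult_right_mono) auto
      moreover have "(card F + 1) * c = \<delta> / 4"
        by (simp add: c_def field_simps)
      ultimately have cA: "card ?A * c \<le> \<delta> / 4"
        by linarith
      have "\<exists>s\<in>?A. c \<le> \<bar>?t s\<bar>"
      proof (rule ccontr)
        assume "\<not> (\<exists>s\<in>?A. c \<le> \<bar>?t s\<bar>)"
        hence "(\<Sum>s\<in>?A. \<bar>?t s\<bar>) \<le> card ?A * c"
          by (intro sum_bounded_above) auto
        thus False
          using A cA by simp
      qed
      thus ?thesis
        using S \<gamma> by (auto simp: G_def selectors_def)
    qed simp
  qed
  ultimately show thesis
    using that F E by blast
qed


section \<open>The cardinality argument\<close>

lemma card_of_finite_Union_fibres_ordLess:
  assumes \<tau>: "Cinfinite \<tau>" and "finite F"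
    and fibres: "\<And>i. |{\<gamma> \<in> \<Gamma>. p \<gamma> = i}| <o \<tau>"
  shows "|{\<gamma> \<in> \<Gamma>. p \<gamma> \<in> F}| <o \<tau>"
  using \<open>finite F\<close>
proof (induction F)
  case empty
  show ?case
    using fibres[of undefined] card_of_mono1[of "{\<gamma> \<in> \<Gamma>. p \<gamma> \<in> {}}" "{\<gamma> \<in> \<Gamma>. p \<gamma> = undefined}"]
    by (auto intro: ordLeq_ordLess_trans)
next
  case (insert i F)
  have "{\<gamma> \<in> \<Gamma>. p \<gamma> \<in> insert i F} = {\<gamma> \<in> \<Gamma>. p \<gamma> = i} \<union> {\<gamma> \<in> \<Gamma>. p \<gamma> \<in> F}"
    by blast
  thus ?case
    using card_of_Un_ordLess_infinite_Field[OF _ _ fibres insert.IH] \<tau> by (simp add: cinfinite_def)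
qed

lemma l1_sum_c0_not_contains_c0:
  fixes \<tau> :: "'g rel" and p :: "'h \<Rightarrow> 'i"
  assumes \<tau>: "Cinfinite \<tau>" and fibres: "\<And>i. |{s \<in> \<Delta>. p s = i}| <o \<tau>"
  shows "\<not> contains_complemented_copy (l1_sum_c0 \<Delta> p) (c0_space (Field \<tau>))"
proof
  assume "contains_complemented_copy (l1_sum_c0 \<Delta> p) (c0_space (Field \<tau>))"
  from contains_complemented_copyE[OF normed_space_l1_sum_c0 normed_space_c0_space this]
  obtain T \<delta> where "bounded_linear_between (c0_space (Field \<tau>)) (l1_sum_c0 \<Delta> p) T" "\<delta> > 0"
    "\<And>f. f \<in> vecs (c0_space (Field \<tau>)) \<Longrightarrow>
        \<delta> * nrm (c0_space (Field \<tau>)) f \<le> nrm (l1_sum_c0 \<Delta> p) (T f)"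
    by blast
  from embedding_c0_into_l1_sum_c0[OF this] obtain F :: "'i set" and E G
    where F: "finite F" and E: "finite E" and G: "\<And>s. finite (G s)"
      and cover: "Field \<tau> \<subseteq> E \<union> (\<Union>s\<in>{s\<in>\<Delta>. p s \<in> F}. G s)"
    by blast
  let ?W = "{s\<in>\<Delta>. p s \<in> F}"
  have W: "|?W| <o \<tau>"
    using card_of_finite_Union_fibres_ordLess[OF \<tau> F fibres] .
  have inf: "infinite (Field \<tau>)"
    using \<tau> by (simp add: cinfinite_def)
  have "infinite ?W"
    using inf cover E G finite_subset by (metis finite_UN_I finite_UnI)
  have small: "|A| \<le>o |?W|" if "finite A" for A :: "'g set"
  proof (rule ordLess_imp_ordLeq)
    show "|A| <o |?W|"
      using that \<open>infinite ?W\<close> by (intro finite_ordLess_infinite) (simp_all add: Field_card_of card_of_well_order_on)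
  qed
  have "|\<Union>s\<in>?W. G s| \<le>o |?W|"
    using \<open>infinite ?W\<close> small[OF G] card_of_mono1[OF subset_refl]
    by (intro card_of_UNION_ordLeq_infinite) blast+
  hence "|E \<union> (\<Union>s\<in>?W. G s)| \<le>o |?W|"
    using \<open>infinite ?W\<close> small[OF E]
    by (intro card_of_Un_ordLeq_infinite_Field) (simp_all add: Field_card_of card_of_card_order_on)
  hence "|Field \<tau>| \<le>o |?W|"
    using card_of_mono1[OF cover] by (rule ordLeq_transitive[rotated])
  hence "|Field \<tau>| <o \<tau>"
    using W by (rule ordLeq_ordLess_trans)
  moreover have "|Field \<tau>| =o \<tau>"
    using \<tau> by (simp add: card_of_Field_ordIso)
  ultimately show False
    using not_ordLess_ordIso by blast
qed

text \<open>The range of a cofinal family indexed by the cofinality is itself indexed by its own cardinal,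
  so by minimality it is not smaller than the cofinality.\<close>

lemma cofinal_set_of_cofinality:
  assumes \<tau>: "Cinfinite \<tau>"
  obtains D where "D \<subseteq> Field \<tau>" "cofinal D \<tau>" "cofinality \<tau> =o |D|"
proof -
  have cof: "is_cofinality \<tau> (cofinality \<tau>)"
    using \<tau> by (rule is_cofinality_cofinality)
  then obtain \<beta> where \<beta>: "\<beta> ` Field (cofinality \<tau>) \<subseteq> Field \<tau>" "cofinal (\<beta> ` Field (cofinality \<tau>)) \<tau>"
    and card: "Card_order (cofinality \<tau>)"
    unfolding is_cofinality_def has_cofinal_family_def by blast
  let ?D = "\<beta> ` Field (cofinality \<tau>)"
  have "has_cofinal_family \<tau> |?D|"
    unfolding has_cofinal_family_def using \<beta>
    by (intro conjI exI[of _ id]) (simp_all add: Field_card_of card_of_card_order_on)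
  hence "cofinality \<tau> \<le>o |?D|"
    using cof unfolding is_cofinality_def by blast
  moreover have "|?D| \<le>o cofinality \<tau>"
    using card_of_image card_of_Field_ordIso[OF card] by (rule ordLeq_ordIso_trans)
  ultimately show thesis
    using that[OF \<beta>] by (simp add: ordIso_iff_ordLeq)
qed


theorem mainTheorem2:
  fixes \<tau> :: "'g rel"
  assumes "Cinfinite \<tau>"
  shows "\<exists>(K :: 'g topology) (X :: ('g \<Rightarrow> real) nspace).
           compact_space K \<and> Hausdorff_space K \<and> banach_space X \<and>
           cofinality \<tau> =o weight K \<and>
           contains_complemented_copy (C_space K X) (c0_space (Field \<tau>)) \<and>
           \<not> contains_complemented_copy X (c0_space (Field \<tau>))"
proof -
  obtain D where D: "D \<subseteq> Field \<tau>" "cofinal D \<tau>" "cofinality \<tau> =o |D|"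
    using cofinal_set_of_cofinality[OF assms] .
  have inf: "infinite (Field \<tau>)"
    using assms by (simp add: cinfinite_def)
  then obtain w where w: "w \<in> D"
    using D(2) unfolding cofinal_def by (metis finite.emptyI all_not_in_conv)
  have wo: "Well_order \<tau>"
    using assms by (simp add: card_order_on_well_order_on)
  hence trans: "trans \<tau>" and antisym: "antisym \<tau>"
    by (simp_all add: order_on_defs)
  \<comment> \<open>Two elements of \<open>D\<close> above \<open>\<gamma>\<close> are found, one of which differs from \<open>w\<close>.\<close>
  have "\<forall>\<gamma>\<in>Field \<tau>. \<exists>i\<in>D - {w}. \<gamma> \<in> underS \<tau> i"
  proof
    fix \<gamma> assume "\<gamma> \<in> Field \<tau>"
    then obtain i where i: "i \<in> D" "\<gamma> \<noteq> i" "(\<gamma>, i) \<in> \<tau>"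
      using D(2) unfolding cofinal_def by blast
    then obtain j where j: "j \<in> D" "i \<noteq> j" "(i, j) \<in> \<tau>"
      using D unfolding cofinal_def by blast
    have "(\<gamma>, j) \<in> \<tau>" "\<gamma> \<noteq> j"
      using i j trans antisym by (auto dest: transD antisymD)
    thus "\<exists>i\<in>D - {w}. \<gamma> \<in> underS \<tau> i"
      using i j by (cases "i = w") (auto simp: underS_def)
  qed
  then obtain p where p: "\<And>\<gamma>. \<gamma> \<in> Field \<tau> \<Longrightarrow> p \<gamma> \<in> D - {w} \<and> \<gamma> \<in> underS \<tau> (p \<gamma>)"
    by metis
  have fibres: "|{\<gamma> \<in> Field \<tau>. p \<gamma> = i}| <o \<tau>" for i
  proof (cases "i \<in> D")
    case True
    have "{\<gamma> \<in> Field \<tau>. p \<gamma> = i} \<subseteq> underS \<tau> i"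
      using p by blast
    thus ?thesis
      using card_of_mono1 card_of_underS[of \<tau> i] assms D(1) True by (blast intro: ordLeq_ordLess_trans)
  next
    case False
    \<comment> \<open>The fibre is empty, and \<open>w\<close> supplies some initial segment to compare it with.\<close>
    hence "{\<gamma> \<in> Field \<tau>. p \<gamma> = i} \<subseteq> underS \<tau> w"
      using p by blast
    thus ?thesis
      using card_of_mono1 card_of_underS[of \<tau> w] assms D(1) w by (blast intro: ordLeq_ordLess_trans)
  qed
  \<comment> \<open>Otherwise \<open>\<tau>\<close> would be a finite union of fibres.\<close>
  have "infinite D"
  proof
    assume "finite D"
    hence "|{\<gamma> \<in> Field \<tau>. p \<gamma> \<in> D}| <o \<tau>"
      using fibres by (intro card_of_finite_Union_fibres_ordLess[OF assms])
    moreover have "{\<gamma> \<in> Field \<tau>. p \<gamma> \<in> D} = Field \<tau>"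
      using p by blast
    ultimately show False
      using card_of_Field_ordIso[of \<tau>] assms not_ordLess_ordIso by metis
  qed
  hence "cofinality \<tau> =o weight (fort_space D w)"
    using D(3) weight_fort_space[OF _ w] ordIso_symmetric ordIso_transitive by blast
  moreover have "contains_complemented_copy (C_space (fort_space D w) (l1_sum_c0 (Field \<tau>) p)) (c0_space (Field \<tau>))"
    using p by (intro C_space_fort_space_contains_complemented_c0[OF w]) blast
  moreover have "\<not> contains_complemented_copy (l1_sum_c0 (Field \<tau>) p) (c0_space (Field \<tau>))"
    using fibres by (rule l1_sum_c0_not_contains_c0[OF assms])
  ultimately show ?thesis
    using compact_space_fort_space[OF w] Hausdorff_space_fort_space[of D w] banach_space_l1_sum_c0[of "Field \<tau>" p]
    by blast
qed

end
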